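(* Let $d\geq 2$ and $p\in\{0,1,\dots,d\}$. For $k\in\{1,\dots,d-1\}$ let $\gamma_k:\mathbb{R}^d\to\mathbb{R}^d$ be $$\gamma_k(x_1,\dots,x_d)=(-x_1,\dots,-x_k,x_{k+1},\dots,x_d),$$ let $a\in(\frac12\mathbb{Z})^d$ be a vector at least one of whose last $d-k$ entries equals $\frac12$, and let $\rho_k=\gamma_k\circ L_a$, where $L_a$ is translation by $a$. Let $\Sigma_k$ (respectively $\Sigma_k'$) be the discrete subgroup of the Euclidean motion group $\mathbb{R}^d\rtimes O(d)$ generated by the translation lattice $\mathbb{Z}^d$ together with $\gamma_k$ (respectively $\rho_k$), and set $\mathcal{O}_k:=\Sigma_k\backslash\mathbb{R}^d$ and $M_k:=\Sigma_k'\backslash\mathbb{R}^d$. (1) Suppose that $K^d_p(k)=0$, where $K^d_p(x)=\sum_{j=0}^p(-1)^j\binom{x}{j}\binom{d-x}{p-j}$ is the Krawtchouk polynomial. Then $\mathcal{O}_k$ and $M_k$ are $p$-isospectral. (2) Moreover, if $k'\in\{1,\dots,d-1\}$ is another zero of $K^d_p$, then $M_k,M_{k'},\mathcal{O}_k,\mathcal{O}_{k'}$ are all mutually $p$-isospectral. (3) For all $k\in\{1,\dots,d-1\}$, $M_k$ is a manifold, whereas the singular set of $\mathcal{O}_k$ consists precisely of $2^k$ singular strata, each of which has codimension $k$. (4) $\mathcal{O}_k$ and $M_k$ are orientable if and only if $k$ is even.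
   Context: For a discrete cocompact subgroup $\Sigma$ of $\mathbb{R}^d\rtimes O(d)$, the quotient $\Sigma\backslash\mathbb{R}^d$ is a closed flat Riemannian orbifold, which is a manifold exactly when $\Sigma$ acts freely. A point is singular if the stabilizer in $\Sigma$ of a lift is non-trivial; its isotropy type is the conjugacy class in $O(d)$ of the linear part of that stabilizer, and the singular strata are the connected components of the sets of singular points having a fixed isotropy type. The $p$-spectrum is the spectrum (with multiplicities) of the Hodge Laplacian on smooth $p$-forms of the orbifold (i.e. $\Sigma$-invariant smooth $p$-forms on $\mathbb{R}^d$); two closed Riemannian orbifolds are $p$-isospectral if they have the same $p$-spectrum. Binomial coefficients satisfy $\binom{m}{n}=0$ for integers $n>m\ge 0$. An orbifold is orientable if it carries a nowhere vanishing continuous $d$-form. *)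

theory Defs
  imports
    "HOL-Analysis.Analysis"
    "HOL-Library.Function_Algebras"
    "HOL-Algebra.Generated_Groups"
begin

section \<open>Euclidean motions and the associated flat orbifolds\<close>

definition motion_group :: "('a::euclidean_space \<Rightarrow> 'a) monoid" where
  "motion_group =
     \<lparr>carrier = {f. \<exists>A b. orthogonal_transformation A \<and> f = (\<lambda>x. A x + b)},
      mult = (\<lambda>f g. f \<circ> g), one = id\<rparr>"

lemma group_motion_group: "group (motion_group :: ('a::euclidean_space \<Rightarrow> 'a) monoid)"
proof (rule groupI)
  fix f g :: "'a \<Rightarrow> 'a"
  assume f: "f \<in> carrier motion_group" and g: "g \<in> carrier motion_group"
  from f obtain A b where A: "orthogonal_transformation A" "f = (\<lambda>x. A x + b)"
    by (auto simp: motion_group_def)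
  from g obtain B c where B: "orthogonal_transformation B" "g = (\<lambda>x. B x + c)"
    by (auto simp: motion_group_def)
  have "f \<circ> g = (\<lambda>x. (A \<circ> B) x + (A c + b))"
    using A B by (auto simp: fun_eq_iff orthogonal_transformation_def linear_add)
  then have "\<exists>C e. orthogonal_transformation C \<and> f \<circ> g = (\<lambda>x. C x + e)"
    using orthogonal_transformation_compose[OF A(1) B(1)] by blast
  then show "f \<otimes>\<^bsub>motion_group\<^esub> g \<in> carrier motion_group"
    by (simp add: motion_group_def)
next
  have "\<exists>A b. orthogonal_transformation A \<and> id = (\<lambda>x::'a. A x + b)"
    using orthogonal_transformation_id by (intro exI[of _ "\<lambda>x. x"] exI[of _ 0]) auto
  then show "\<one>\<^bsub>motion_group\<^esub> \<in> carrier (motion_group :: ('a \<Rightarrow> 'a) monoid)"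
    by (simp add: motion_group_def)
next
  fix f :: "'a \<Rightarrow> 'a"
  assume f: "f \<in> carrier motion_group"
  then obtain A b where A: "orthogonal_transformation A" "f = (\<lambda>x. A x + b)"
    by (auto simp: motion_group_def)
  define B where "B = inv_into UNIV A"
  have B: "orthogonal_transformation B"
    unfolding B_def by (rule orthogonal_transformation_inv[OF A(1)])
  have BA: "B (A x) = x" for x
    unfolding B_def using orthogonal_transformation_inj[OF A(1)] by simp
  let ?g = "\<lambda>x. B x + (- B b)"
  have "?g \<circ> f = id"
    using B BA A by (auto simp: fun_eq_iff orthogonal_transformation_def linear_add)
  moreover have "?g \<in> carrier motion_group"
    unfolding motion_group_def partial_object.simps mem_Collect_eq using B by blast
  ultimately show "\<exists>g\<in>carrier motion_group. g \<otimes>\<^bsub>motion_group\<^esub> f = \<one>\<^bsub>motion_group\<^esub>"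
    by (auto simp: motion_group_def)
qed (auto simp: motion_group_def)

text \<open>
  In what follows, \<open>\<Gamma>\<close> is a discrete cocompact subgroup of the motion group, and its quotient
  orbifold is represented by \<open>\<Gamma>\<close> itself: the points are the orbits, and tensors on the orbifold
  are the \<open>\<Gamma>\<close>-invariant tensors on the covering Euclidean space.
\<close>

definition orbit_of :: "('a \<Rightarrow> 'a) set \<Rightarrow> 'a \<Rightarrow> 'a set" where
  "orbit_of \<Gamma> x = (\<lambda>f. f x) ` \<Gamma>"

definition orbifold_topology :: "('a::euclidean_space \<Rightarrow> 'a) set \<Rightarrow> 'a set topology" where
  "orbifold_topology \<Gamma> =
     topology (\<lambda>U. U \<subseteq> range (orbit_of \<Gamma>) \<and> open {x. orbit_of \<Gamma> x \<in> U})"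

lemma openin_orbifold_topology:
  "openin (orbifold_topology \<Gamma>) U \<longleftrightarrow>
     U \<subseteq> range (orbit_of \<Gamma>) \<and> open {x. orbit_of \<Gamma> x \<in> U}"
proof -
  have "istopology (\<lambda>U. U \<subseteq> range (orbit_of \<Gamma>) \<and> open {x. orbit_of \<Gamma> x \<in> U})"
    unfolding istopology_def
  proof (intro conjI allI impI)
    fix S T assume "S \<subseteq> range (orbit_of \<Gamma>) \<and> open {x. orbit_of \<Gamma> x \<in> S}"
      and "T \<subseteq> range (orbit_of \<Gamma>) \<and> open {x. orbit_of \<Gamma> x \<in> T}"
    then show "S \<inter> T \<subseteq> range (orbit_of \<Gamma>)" "open {x. orbit_of \<Gamma> x \<in> S \<inter> T}"
      by (auto simp: open_Collect_conj)
  next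
    fix \<K> assume K: "\<forall>K\<in>\<K>. K \<subseteq> range (orbit_of \<Gamma>) \<and> open {x. orbit_of \<Gamma> x \<in> K}"
    then show "\<Union>\<K> \<subseteq> range (orbit_of \<Gamma>)" by auto
    have "{x. orbit_of \<Gamma> x \<in> \<Union>\<K>} = (\<Union>K\<in>\<K>. {x. orbit_of \<Gamma> x \<in> K})" by auto
    then show "open {x. orbit_of \<Gamma> x \<in> \<Union>\<K>}" using K by auto
  qed
  then show ?thesis
    unfolding orbifold_topology_def by (simp add: topology_inverse')
qed

definition stabilizer_of :: "('a \<Rightarrow> 'a) set \<Rightarrow> 'a \<Rightarrow> ('a \<Rightarrow> 'a) set" where
  "stabilizer_of \<Gamma> x = {f \<in> \<Gamma>. f x = x}"

definition linear_part :: "('a::euclidean_space \<Rightarrow> 'a) \<Rightarrow> 'a \<Rightarrow> 'a" where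
  "linear_part f = (\<lambda>x. f x - f 0)"

definition singular_set :: "('a::euclidean_space \<Rightarrow> 'a) set \<Rightarrow> 'a set set" where
  "singular_set \<Gamma> = {orbit_of \<Gamma> x |x. stabilizer_of \<Gamma> x \<noteq> {id}}"

definition is_manifold :: "('a::euclidean_space \<Rightarrow> 'a) set \<Rightarrow> bool" where
  "is_manifold \<Gamma> \<longleftrightarrow> (\<forall>x. stabilizer_of \<Gamma> x = {id})"

text \<open>The conjugacy class, in the orthogonal group, of the linear part of the stabilizer.\<close>

definition isotropy_type :: "('a::euclidean_space \<Rightarrow> 'a) set \<Rightarrow> 'a \<Rightarrow> ('a \<Rightarrow> 'a) set set" where
  "isotropy_type \<Gamma> x =
     {(\<lambda>A. B \<circ> A \<circ> inv_into UNIV B) ` linear_part ` stabilizer_of \<Gamma> x |B.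
        orthogonal_transformation B}"

definition singular_points_of_type ::
    "('a::euclidean_space \<Rightarrow> 'a) set \<Rightarrow> ('a \<Rightarrow> 'a) set set \<Rightarrow> 'a set set" where
  "singular_points_of_type \<Gamma> \<tau> =
     {orbit_of \<Gamma> x |x. stabilizer_of \<Gamma> x \<noteq> {id} \<and> isotropy_type \<Gamma> x = \<tau>}"

definition singular_strata :: "('a::euclidean_space \<Rightarrow> 'a) set \<Rightarrow> 'a set set set" where
  "singular_strata \<Gamma> =
     (\<Union>\<tau>. connected_components_of
            (subtopology (orbifold_topology \<Gamma>) (singular_points_of_type \<Gamma> \<tau>)))"

definition locally_euclidean :: "nat \<Rightarrow> 'b topology \<Rightarrow> bool" where
  "locally_euclidean m X \<longleftrightarrow>
     (\<forall>x\<in>topspace X. \<exists>U W. openin X U \<and> x \<in> U \<and> openin (Euclidean_space m) W \<and>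
        subtopology X U homeomorphic_space subtopology (Euclidean_space m) W)"

definition has_codimension ::
    "('a::euclidean_space \<Rightarrow> 'a) set \<Rightarrow> 'a set set \<Rightarrow> nat \<Rightarrow> bool" where
  "has_codimension \<Gamma> S c \<longleftrightarrow>
     c \<le> DIM('a) \<and> locally_euclidean (DIM('a) - c) (subtopology (orbifold_topology \<Gamma>) S)"


section \<open>Differential forms and the Hodge Laplacian\<close>

text \<open>
  A differential form \<open>\<omega>\<close> on a Euclidean space sends a point \<open>x\<close> and a list \<open>vs\<close> of tangent vectors
  to the value of \<open>\<omega>\<close> at \<open>x\<close> on \<open>vs\<close>. Forms of degree \<open>p\<close> are required to vanish on lists of
  length other than \<open>p\<close>, so that equality of forms is equality of functions.
\<close>

type_synonym 'a dform = "'a \<Rightarrow> 'a list \<Rightarrow> real"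

definition alternating_form :: "nat \<Rightarrow> ('a::euclidean_space list \<Rightarrow> real) \<Rightarrow> bool" where
  "alternating_form p \<alpha> \<longleftrightarrow>
     (\<forall>vs. length vs \<noteq> p \<longrightarrow> \<alpha> vs = 0) \<and>
     (\<forall>vs i. length vs = p \<longrightarrow> i < p \<longrightarrow> linear (\<lambda>v. \<alpha> (vs[i := v]))) \<and>
     (\<forall>vs. length vs = p \<longrightarrow> \<not> distinct vs \<longrightarrow> \<alpha> vs = 0)"

primrec times_differentiable :: "nat \<Rightarrow> ('a::euclidean_space \<Rightarrow> real) \<Rightarrow> bool" where
  "times_differentiable 0 f \<longleftrightarrow> continuous_on UNIV f"
| "times_differentiable (Suc n) f \<longleftrightarrow>
     (\<forall>x. f differentiable (at x)) \<and>
     (\<forall>v. times_differentiable n (\<lambda>x. frechet_derivative f (at x) v))"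

definition smooth_function :: "('a::euclidean_space \<Rightarrow> real) \<Rightarrow> bool" where
  "smooth_function f \<longleftrightarrow> (\<forall>n. times_differentiable n f)"

definition smooth_form :: "nat \<Rightarrow> 'a::euclidean_space dform \<Rightarrow> bool" where
  "smooth_form p \<omega> \<longleftrightarrow>
     (\<forall>x. alternating_form p (\<omega> x)) \<and> (\<forall>vs. smooth_function (\<lambda>x. \<omega> x vs))"

definition continuous_form :: "nat \<Rightarrow> 'a::euclidean_space dform \<Rightarrow> bool" where
  "continuous_form p \<omega> \<longleftrightarrow>
     (\<forall>x. alternating_form p (\<omega> x)) \<and> (\<forall>vs. continuous_on UNIV (\<lambda>x. \<omega> x vs))"

definition pullback_form :: "('a \<Rightarrow> 'a) \<Rightarrow> 'a::euclidean_space dform \<Rightarrow> 'a dform" where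
  "pullback_form f \<omega> = (\<lambda>x vs. \<omega> (f x) (map (frechet_derivative f (at x)) vs))"

definition invariant_form :: "('a \<Rightarrow> 'a) set \<Rightarrow> 'a::euclidean_space dform \<Rightarrow> bool" where
  "invariant_form \<Gamma> \<omega> \<longleftrightarrow> (\<forall>f\<in>\<Gamma>. pullback_form f \<omega> = \<omega>)"

text \<open>
  The invariant formula for the exterior derivative, evaluated on constant vector fields (whose
  Lie brackets vanish); \<open>take i vs @ drop (Suc i) vs\<close> omits the \<open>i\<close>-th entry.
\<close>

definition ext_deriv :: "'a::euclidean_space dform \<Rightarrow> 'a dform" where
  "ext_deriv \<omega> = (\<lambda>x vs. \<Sum>i<length vs. (-1) ^ i *
     frechet_derivative (\<lambda>y. \<omega> y (take i vs @ drop (Suc i) vs)) (at x) (vs ! i))"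

text \<open>
  The codifferential (the formal adjoint of the exterior derivative) of the flat metric: minus the
  trace of the covariant derivative, which is the ordinary derivative here.
\<close>

definition codiff :: "'a::euclidean_space dform \<Rightarrow> 'a dform" where
  "codiff \<omega> = (\<lambda>x vs. - (\<Sum>b\<in>Basis. frechet_derivative (\<lambda>y. \<omega> y (b # vs)) (at x) b))"

definition hodge_laplacian :: "'a::euclidean_space dform \<Rightarrow> 'a dform" where
  "hodge_laplacian \<omega> = ext_deriv (codiff \<omega>) + codiff (ext_deriv \<omega>)"

definition scale_form :: "real \<Rightarrow> 'a dform \<Rightarrow> 'a dform" where
  "scale_form c \<omega> = (\<lambda>x vs. c * \<omega> x vs)"

global_interpretation dform: vector_space "scale_form :: real \<Rightarrow> 'a dform \<Rightarrow> 'a dform"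
  by unfold_locales (auto simp: scale_form_def fun_eq_iff algebra_simps)

definition eigenforms ::
    "('a::euclidean_space \<Rightarrow> 'a) set \<Rightarrow> nat \<Rightarrow> real \<Rightarrow> 'a dform set" where
  "eigenforms \<Gamma> p \<mu> =
     {\<omega>. smooth_form p \<omega> \<and> invariant_form \<Gamma> \<omega> \<and> hodge_laplacian \<omega> = scale_form \<mu> \<omega>}"

text \<open>
  The spectrum as the function that sends a real number to its multiplicity as an eigenvalue, i.e.
  the dimension of the eigenspace (\<open>0\<close> exactly for the numbers that are not eigenvalues). The
  dimension is extended-valued, so that an infinite-dimensional space is not assigned dimension 0.
\<close>

definition p_spectrum :: "nat \<Rightarrow> ('a::euclidean_space \<Rightarrow> 'a) set \<Rightarrow> real \<Rightarrow> enat" where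
  "p_spectrum p \<Gamma> \<mu> =
     (SUP B \<in> {B. B \<subseteq> eigenforms \<Gamma> p \<mu> \<and> finite B \<and> dform.independent B}. enat (card B))"

definition p_isospectral ::
    "nat \<Rightarrow> ('a::euclidean_space \<Rightarrow> 'a) set \<Rightarrow> ('a \<Rightarrow> 'a) set \<Rightarrow> bool" where
  "p_isospectral p \<Gamma> \<Gamma>' \<longleftrightarrow> p_spectrum p \<Gamma> = p_spectrum p \<Gamma>'"

definition orientable_orbifold :: "('a::euclidean_space \<Rightarrow> 'a) set \<Rightarrow> bool" where
  "orientable_orbifold \<Gamma> \<longleftrightarrow>
     (\<exists>\<omega>. continuous_form DIM('a) \<omega> \<and> invariant_form \<Gamma> \<omega> \<and> (\<forall>x. \<exists>vs. \<omega> x vs \<noteq> 0))"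


section \<open>The Krawtchouk polynomials and the groups\<close>

definition krawtchouk :: "nat \<Rightarrow> nat \<Rightarrow> real \<Rightarrow> real" where
  "krawtchouk d p x = (\<Sum>j=0..p. (-1) ^ j * (x gchoose j) * ((real d - x) gchoose (p - j)))"

text \<open>
  The coordinates \<open>1, \<dots>, d\<close> are the elements of a linearly ordered type with \<open>d\<close> elements;
  \<open>coord_number\<close> is the order isomorphism onto \<open>{1..d}\<close>.
\<close>

definition coord_number :: "'n::{finite,linorder} \<Rightarrow> nat" where
  "coord_number i = card {j. j \<le> i}"

definition reflect_first :: "nat \<Rightarrow> (real, 'n::{finite,linorder}) vec \<Rightarrow> (real, 'n) vec" where
  "reflect_first k x = (\<chi> i. if coord_number i \<le> k then - (x $ i) else x $ i)"

definition translation :: "(real, 'n::finite) vec \<Rightarrow> (real, 'n) vec \<Rightarrow> (real, 'n) vec" where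
  "translation a x = x + a"

definition lattice_translations :: "((real, 'n::finite) vec \<Rightarrow> (real, 'n) vec) set" where
  "lattice_translations = translation ` {b. \<forall>i. b $ i \<in> \<int>}"

definition half_vector :: "nat \<Rightarrow> (real, 'n::{finite,linorder}) vec \<Rightarrow> bool" where
  "half_vector k a \<longleftrightarrow>
     (\<forall>i. 2 * a $ i \<in> \<int>) \<and> (\<exists>i. k < coord_number i \<and> a $ i = 1 / 2)"

definition O_group :: "nat \<Rightarrow> ((real, 'n::{finite,linorder}) vec \<Rightarrow> (real, 'n) vec) set" where
  "O_group k = generate motion_group (insert (reflect_first k) lattice_translations)"

definition M_group ::
    "nat \<Rightarrow> (real, 'n::{finite,linorder}) vec \<Rightarrow> ((real, 'n) vec \<Rightarrow> (real, 'n) vec) set" where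
  "M_group k a =
     generate motion_group (insert (reflect_first k \<circ> translation a) lattice_translations)"

end

(*
The Hodge Laplacian of flat space acts componentwise, so a p-eigenform for the group generated by the
lattice and rho = gamma_k o L_a is a family of lattice-periodic scalar eigenfunctions f_I, indexed by
the p-subsets I of the coordinates, with f_I o rho = (-1)^|I \<inter> {1,...,k}| f_I. The value K(k) of the
Krawtchouk polynomial is the sum of these signs, so K(k) = 0 says that half of the subsets have either
sign. Since rho acts as an involution on the space F of all periodic scalar eigenfunctions, F is the
direct sum of its two sign parts, and pairing the even subsets with the odd ones identifies the
eigenspace with F^N, N = (d choose p) / 2, which depends on neither k nor a. No Fourier analysis and
no finiteness of F is needed. The group of O_k is the case a = 0.

The singular points of O_k are the orbits of the x with 2 x_i integral for i \<le> k. Fixing x_i modulo 1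
to be 0 or 1/2 for each i \<le> k cuts the singular set into 2^k connected closed pieces, on which the group
acts through translations of the last d - k coordinates. For odd k the only component of
an invariant d-form changes sign under rho and hence vanishes somewhere.
*)

theory Submission
  imports Defs "HOL-Combinatorics.Permutations"
begin

section \<open>Smooth functions and the Hodge Laplacian\<close>

text \<open>The dictionary between forms and families of scalar functions has two halves: an
  alternating form is determined by its values on increasing lists of basis vectors, and every
  choice of such values is attained. The second half is why the forms dx_I are built explicitly as
  determinants. Componentwise action of the Laplacian rests on the symmetry of mixed derivatives,
  which is derived from the iterated directional derivatives that define smoothness. A multiplicity
  is a supremum over finite independent sets and might be infinite, so spectra are compared through
  explicit linear maps with left inverses, one in each direction, and not through dimension counts.
  The square of rho is the translation by a + gamma_k a, whose entries are 0 or 2 a_i. This lattice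
  vector is what makes rho an involution on periodic functions. An entry 1/2 of a beyond the first k
  coordinates is what makes the action free.\<close>

definition dir_deriv :: "'a::euclidean_space \<Rightarrow> ('a \<Rightarrow> real) \<Rightarrow> 'a \<Rightarrow> real" where
  "dir_deriv v f = (\<lambda>x. frechet_derivative f (at x) v)"

lemma smooth_function_differentiable: "smooth_function f \<Longrightarrow> f differentiable (at x)"
  unfolding smooth_function_def by (metis times_differentiable.simps(2))

lemma smooth_function_dir_deriv: "smooth_function f \<Longrightarrow> smooth_function (dir_deriv v f)"
  unfolding smooth_function_def dir_deriv_def by (metis times_differentiable.simps(2))

lemma smooth_function_continuous: "smooth_function f \<Longrightarrow> continuous_on UNIV f"
  unfolding smooth_function_def by (metis times_differentiable.simps(1))

lemma dir_deriv_works: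
  "f differentiable (at x) \<Longrightarrow> (f has_derivative (\<lambda>v. dir_deriv v f x)) (at x)"
  unfolding dir_deriv_def using frechet_derivative_works by auto

lemma dir_deriv_unique:
  "(f has_derivative f') (at x) \<Longrightarrow> dir_deriv v f x = f' v"
  unfolding dir_deriv_def by (simp add: frechet_derivative_at[symmetric])

lemma dir_deriv_const: "dir_deriv v (\<lambda>x. c) = (\<lambda>x. 0)"
  by (simp add: dir_deriv_def)

lemma dir_deriv_add:
  assumes "\<And>x. f differentiable (at x)" "\<And>x. g differentiable (at x)"
  shows "dir_deriv v (\<lambda>x. f x + g x) = (\<lambda>x. dir_deriv v f x + dir_deriv v g x)"
  by (rule ext, rule dir_deriv_unique) (intro derivative_intros dir_deriv_works assms)

lemma dir_deriv_cmult:
  assumes "\<And>x. f differentiable (at x)"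
  shows "dir_deriv v (\<lambda>x. c * f x) = (\<lambda>x. c * dir_deriv v f x)"
  by (rule ext, rule dir_deriv_unique) (intro derivative_intros dir_deriv_works assms)

lemma dir_deriv_sum:
  assumes "\<And>i x. i \<in> I \<Longrightarrow> f i differentiable (at x)"
  shows "dir_deriv v (\<lambda>x. \<Sum>i\<in>I. f i x) = (\<lambda>x. \<Sum>i\<in>I. dir_deriv v (f i) x)"
  by (rule ext, rule dir_deriv_unique) (intro derivative_intros dir_deriv_works assms)

lemma dir_deriv_uminus_dir:
  assumes "f differentiable (at x)"
  shows "dir_deriv (- v) f x = - dir_deriv v f x"
  using linear_neg[OF has_derivative_linear[OF dir_deriv_works[OF assms]]] by simp

lemma has_derivative_affine:
  fixes A :: "'b::euclidean_space \<Rightarrow> 'a::euclidean_space"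
  assumes "f differentiable (at (A x + c))" "linear A"
  shows "((\<lambda>x. f (A x + c)) has_derivative (\<lambda>v. dir_deriv (A v) f (A x + c))) (at x)"
proof -
  have "((\<lambda>x. A x + c) has_derivative A) (at x)"
    using assms(2) linear_conv_bounded_linear
    by (auto intro!: derivative_eq_intros bounded_linear_imp_has_derivative)
  then show ?thesis
    by (rule has_derivative_compose[where f = "\<lambda>x. A x + c" and g = f and g' = "\<lambda>v. dir_deriv v f (A x + c)",
      OF _ dir_deriv_works[OF assms(1)]])
qed

lemma dir_deriv_affine:
  assumes "\<And>x. f differentiable (at x)" "linear A"
  shows "dir_deriv v (\<lambda>x. f (A x + c)) = (\<lambda>x. dir_deriv (A v) f (A x + c))"
  by (rule ext, rule dir_deriv_unique) (rule has_derivative_affine[OF assms])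

lemma times_differentiable_Suc_dir_deriv:
  "times_differentiable (Suc n) f \<longleftrightarrow>
     (\<forall>x. f differentiable (at x)) \<and> (\<forall>v. times_differentiable n (dir_deriv v f))"
  by (simp add: dir_deriv_def)

lemma times_differentiable_const: "times_differentiable n (\<lambda>x. c)"
  by (induction n arbitrary: c) (auto simp: dir_deriv_const)

lemma times_differentiable_add:
  "times_differentiable n f \<Longrightarrow> times_differentiable n g \<Longrightarrow> times_differentiable n (\<lambda>x. f x + g x)"
proof (induction n arbitrary: f g)
  case 0 then show ?case by (auto intro: continuous_intros)
next
  case (Suc n) then show ?case
    by (auto simp: times_differentiable_Suc_dir_deriv dir_deriv_add simp del: times_differentiable.simps)
qed

lemma times_differentiable_cmult:
  "times_differentiable n f \<Longrightarrow> times_differentiable n (\<lambda>x. c * f x)"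
proof (induction n arbitrary: f)
  case 0 then show ?case by (auto intro: continuous_intros)
next
  case (Suc n) then show ?case
    by (auto simp: times_differentiable_Suc_dir_deriv dir_deriv_cmult simp del: times_differentiable.simps)
qed

lemma times_differentiable_affine:
  fixes A :: "'b::euclidean_space \<Rightarrow> 'a::euclidean_space"
  assumes "linear A"
  shows "times_differentiable n f \<Longrightarrow> times_differentiable n (\<lambda>x. f (A x + c))"
proof (induction n arbitrary: f)
  case 0
  have "continuous_on UNIV (\<lambda>x. A x + c)"
    using assms by (intro continuous_on_add linear_continuous_on continuous_on_const)
      (simp add: linear_conv_bounded_linear)
  then show ?case
    using 0 continuous_on_compose2[of UNIV f UNIV "\<lambda>x. A x + c"] by simp
next
  case (Suc n)
  have "(\<lambda>x. f (A x + c)) differentiable (at x)" for x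
    unfolding differentiable_def
    by (rule exI, rule has_derivative_affine[OF _ assms]) (use Suc.prems in simp)
  moreover have "dir_deriv v (\<lambda>x. f (A x + c)) = (\<lambda>x. dir_deriv (A v) f (A x + c))" for v
    using Suc.prems by (intro dir_deriv_affine assms) auto
  ultimately show ?case using Suc
    by (simp add: times_differentiable_Suc_dir_deriv del: times_differentiable.simps)
qed

lemma smooth_function_const: "smooth_function (\<lambda>x. c)"
  by (simp add: smooth_function_def times_differentiable_const)

lemma smooth_function_add:
  "smooth_function f \<Longrightarrow> smooth_function g \<Longrightarrow> smooth_function (\<lambda>x. f x + g x)"
  by (simp add: smooth_function_def times_differentiable_add)

lemma smooth_function_cmult: "smooth_function f \<Longrightarrow> smooth_function (\<lambda>x. c * f x)"
  by (simp add: smooth_function_def times_differentiable_cmult)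

lemma smooth_function_affine:
  "linear A \<Longrightarrow> smooth_function f \<Longrightarrow> smooth_function (\<lambda>x. f (A x + c))"
  by (simp add: smooth_function_def times_differentiable_affine)

lemma smooth_function_sum:
  "(\<And>i. i \<in> I \<Longrightarrow> smooth_function (f i)) \<Longrightarrow> smooth_function (\<lambda>x. \<Sum>i\<in>I. f i x)"
  by (induction I rule: infinite_finite_induct) (auto intro: smooth_function_const smooth_function_add)

section \<open>Symmetry of mixed directional derivatives\<close>

lemma DERIV_along_line:
  assumes "\<And>x. f differentiable (at x)"
  shows "((\<lambda>t. f (x + t *\<^sub>R v)) has_real_derivative dir_deriv v f (x + t *\<^sub>R v)) (at t)"
proof -
  have "((\<lambda>t. x + t *\<^sub>R v) has_derivative (\<lambda>h. h *\<^sub>R v)) (at t)"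
    by (auto intro!: derivative_eq_intros)
  then have "((\<lambda>t. f (x + t *\<^sub>R v)) has_derivative (\<lambda>h. dir_deriv (h *\<^sub>R v) f (x + t *\<^sub>R v))) (at t)"
    by (rule has_derivative_compose[OF _ dir_deriv_works[OF assms]])
  moreover have "dir_deriv (h *\<^sub>R v) f y = h * dir_deriv v f y" for h y
    using linear_scale[OF has_derivative_linear[OF dir_deriv_works[OF assms]]] by simp
  moreover have "(*) (dir_deriv v f y) = (\<lambda>h. h * dir_deriv v f y)" for y
    by (simp add: fun_eq_iff)
  ultimately show ?thesis by (simp add: has_field_derivative_def)
qed

text \<open>Two applications of the mean value theorem, along u and then along v. The left-hand side
  is symmetric in u and v while the order of differentiation on the right is not, which is what the
  symmetry proof exploits.\<close>

lemma second_difference_mean_value: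
  assumes f: "smooth_function f" and "h > 0"
  obtains s t where "0 < s" "s < h" "0 < t" "t < h"
    "f (x + h *\<^sub>R u + h *\<^sub>R v) - f (x + h *\<^sub>R u) - f (x + h *\<^sub>R v) + f x =
      h * h * dir_deriv v (dir_deriv u f) (x + s *\<^sub>R u + t *\<^sub>R v)"
proof -
  \<comment> \<open>The difference of f across the parallelogram in direction v, as a function of
    the position along u; its increment over [0, h] is the second difference.\<close>
  let ?\<phi> = "\<lambda>s. f ((x + h *\<^sub>R v) + s *\<^sub>R u) - f (x + s *\<^sub>R u)"
  have "\<exists>s>0. s < h \<and> ?\<phi> h - ?\<phi> 0 =
      (h - 0) * (dir_deriv u f ((x + h *\<^sub>R v) + s *\<^sub>R u) - dir_deriv u f (x + s *\<^sub>R u))"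
    using \<open>h > 0\<close>
    by (intro MVT2 DERIV_diff DERIV_along_line smooth_function_differentiable[OF f])
  then obtain s where s: "0 < s" "s < h" "?\<phi> h - ?\<phi> 0 =
      h * (dir_deriv u f ((x + h *\<^sub>R v) + s *\<^sub>R u) - dir_deriv u f (x + s *\<^sub>R u))"
    by auto
  let ?\<psi> = "\<lambda>t. dir_deriv u f ((x + s *\<^sub>R u) + t *\<^sub>R v)"
  have "\<exists>t>0. t < h \<and> ?\<psi> h - ?\<psi> 0 = (h - 0) * dir_deriv v (dir_deriv u f) ((x + s *\<^sub>R u) + t *\<^sub>R v)"
    using \<open>h > 0\<close>
    by (intro MVT2 DERIV_along_line smooth_function_differentiable smooth_function_dir_deriv f)
  then obtain t where t: "0 < t" "t < h"
      "?\<psi> h - ?\<psi> 0 = h * dir_deriv v (dir_deriv u f) ((x + s *\<^sub>R u) + t *\<^sub>R v)"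
    by auto
  show thesis
    by (rule that[OF s(1,2) t(1,2)]) (use s(3) t(3) in \<open>simp add: algebra_simps\<close>)
qed

text \<open>Both mixed derivatives, divided out of the same second difference, take a common value
  at points arbitrarily close to x. If they differed at x, continuity would keep them apart near
  x.\<close>

lemma dir_deriv_commute:
  assumes f: "smooth_function f"
  shows "dir_deriv v (dir_deriv u f) x = dir_deriv u (dir_deriv v f) x"
proof (rule ccontr)
  define F where "F = dir_deriv v (dir_deriv u f)"
  define G where "G = dir_deriv u (dir_deriv v f)"
  assume "\<not> ?thesis"
  then have e: "\<bar>F x - G x\<bar> / 2 > 0" (is "?e > 0") by (simp add: F_def G_def)
  have "isCont F x" "isCont G x"
    using smooth_function_continuous[OF smooth_function_dir_deriv[OF smooth_function_dir_deriv[OF f]]]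
    unfolding F_def G_def by (auto simp: continuous_on_eq_continuous_at)
  then obtain d1 d2 where d: "d1 > 0" "d2 > 0"
    and d1: "\<And>y. dist y x < d1 \<Longrightarrow> \<bar>F y - F x\<bar> < ?e"
    and d2: "\<And>y. dist y x < d2 \<Longrightarrow> \<bar>G y - G x\<bar> < ?e"
    using e unfolding continuous_at_eps_delta dist_real_def by metis
  \<comment> \<open>This size keeps the whole parallelogram within both continuity radii; the
    summand 1 avoids a zero denominator and makes the estimate strict.\<close>
  define h where "h = min d1 d2 / (norm u + norm v + 1)"
  have n: "norm u + norm v + 1 > 0" by (smt (verit) norm_ge_zero)
  then have h: "h > 0" using d by (simp add: h_def)
  have hb: "h * (norm u + norm v + 1) = min d1 d2" using n by (simp add: h_def)
  have close: "dist (x + s *\<^sub>R u + t *\<^sub>R v) x < min d1 d2"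
    if "0 < s" "s < h" "0 < t" "t < h" for s t
  proof -
    have "dist (x + s *\<^sub>R u + t *\<^sub>R v) x = norm (s *\<^sub>R u + t *\<^sub>R v)"
      by (simp add: dist_norm algebra_simps)
    also have "\<dots> \<le> s * norm u + t * norm v"
      using that by (intro norm_triangle_le) simp
    also have "\<dots> \<le> h * norm u + h * norm v"
      using that by (intro add_mono mult_right_mono) auto
    also have "\<dots> < h * (norm u + norm v + 1)" using h by (simp add: algebra_simps)
    also have "\<dots> = min d1 d2" by (rule hb)
    finally show ?thesis .
  qed
  obtain s t where st: "0 < s" "s < h" "0 < t" "t < h" and
    1: "f (x + h *\<^sub>R u + h *\<^sub>R v) - f (x + h *\<^sub>R u) - f (x + h *\<^sub>R v) + f x =
      h * h * F (x + s *\<^sub>R u + t *\<^sub>R v)"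
    using second_difference_mean_value[OF f h, of x u v] unfolding F_def by blast
  obtain s' t' where st': "0 < s'" "s' < h" "0 < t'" "t' < h" and
    2: "f (x + h *\<^sub>R v + h *\<^sub>R u) - f (x + h *\<^sub>R v) - f (x + h *\<^sub>R u) + f x =
      h * h * G (x + s' *\<^sub>R v + t' *\<^sub>R u)"
    using second_difference_mean_value[OF f h, of x v u] unfolding G_def by blast
  have "h * h * F (x + s *\<^sub>R u + t *\<^sub>R v) = h * h * G (x + s' *\<^sub>R v + t' *\<^sub>R u)"
    using 1 2 by (simp add: algebra_simps)
  then have "F (x + s *\<^sub>R u + t *\<^sub>R v) = G (x + t' *\<^sub>R u + s' *\<^sub>R v)"
    using h by (simp add: algebra_simps)
  moreover have "\<bar>F (x + s *\<^sub>R u + t *\<^sub>R v) - F x\<bar> < ?e"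
    using d1 close[OF st] by simp
  moreover have "\<bar>G (x + t' *\<^sub>R u + s' *\<^sub>R v) - G x\<bar> < ?e"
    using d2 close[OF st'(3,4,1,2)] by simp
  moreover have "\<bar>F x - G x\<bar> \<le> \<bar>F y - F x\<bar> + \<bar>G z - G x\<bar>" if "F y = G z" for y z
    using that by (simp add: abs_if)
  ultimately show False by fastforce
qed

text \<open>The sign is the geometric one, matching the minus sign in \<open>codiff\<close>, so that
  the Hodge Laplacian acts on components without a further sign.\<close>

definition laplacian :: "('a::euclidean_space \<Rightarrow> real) \<Rightarrow> 'a \<Rightarrow> real" where
  "laplacian f x = - (\<Sum>b\<in>Basis. dir_deriv b (dir_deriv b f) x)"

lemma laplacian_const: "laplacian (\<lambda>x. c) x = 0"
  by (simp add: laplacian_def dir_deriv_const)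

lemma laplacian_add:
  "smooth_function f \<Longrightarrow> smooth_function g \<Longrightarrow>
    laplacian (\<lambda>x. f x + g x) x = laplacian f x + laplacian g x"
  by (simp add: laplacian_def dir_deriv_add smooth_function_differentiable smooth_function_dir_deriv
      sum.distrib)

lemma laplacian_cmult:
  "smooth_function f \<Longrightarrow> laplacian (\<lambda>x. c * f x) x = c * laplacian f x"
  by (simp add: laplacian_def dir_deriv_cmult smooth_function_differentiable smooth_function_dir_deriv
      sum_distrib_left)

lemma laplacian_sum:
  "(\<And>i. i \<in> I \<Longrightarrow> smooth_function (f i)) \<Longrightarrow>
    laplacian (\<lambda>x. \<Sum>i\<in>I. f i x) x = (\<Sum>i\<in>I. laplacian (f i) x)"
  by (induction I rule: infinite_finite_induct)
    (auto simp: laplacian_const laplacian_add smooth_function_sum)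

text \<open>The mixed terms of \<open>d \<delta>\<close> and \<open>\<delta> d\<close> cancel because partial derivatives commute; alternation of
  the form is not used.\<close>

lemma hodge_laplacian_eq:
  fixes \<omega> :: "'a::euclidean_space dform"
  assumes s: "\<And>vs. smooth_function (\<lambda>x. \<omega> x vs)"
  shows "hodge_laplacian \<omega> x vs = laplacian (\<lambda>y. \<omega> y vs) x"
proof -
  define W where "W ws = (\<lambda>y. \<omega> y ws)" for ws
  define rem where "rem i ws = take i ws @ drop (Suc i) ws" for i and ws :: "'a list"
  note [simp] = smooth_function_differentiable smooth_function_dir_deriv smooth_function_sum
    smooth_function_cmult
  have sW [simp]: "smooth_function (W ws)" for ws using s by (simp add: W_def)
  have cod: "(\<lambda>y. codiff \<omega> y ws) = (\<lambda>y. - 1 * (\<Sum>b\<in>Basis. dir_deriv b (W (b # ws)) y))" for ws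
    by (simp add: codiff_def dir_deriv_def W_def)
  have ext: "(\<lambda>y. ext_deriv \<omega> y ws) =
      (\<lambda>y. \<Sum>i<length ws. (-1) ^ i * dir_deriv (ws ! i) (W (rem i ws)) y)" for ws
    by (simp add: ext_deriv_def dir_deriv_def W_def rem_def)
  have "ext_deriv (codiff \<omega>) x vs =
      (\<Sum>i<length vs. (-1) ^ i * dir_deriv (vs ! i) (\<lambda>y. codiff \<omega> y (rem i vs)) x)"
    by (simp add: ext_deriv_def dir_deriv_def rem_def)
  also have "\<dots> = (\<Sum>i<length vs. (-1) ^ i *
      (- (\<Sum>b\<in>Basis. dir_deriv (vs ! i) (dir_deriv b (W (b # rem i vs))) x)))"
    unfolding cod by (subst dir_deriv_cmult) (simp_all add: dir_deriv_sum)
  finally have 1: "ext_deriv (codiff \<omega>) x vs = (\<Sum>i<length vs. \<Sum>b\<in>Basis.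
      - ((-1) ^ i * dir_deriv (vs ! i) (dir_deriv b (W (b # rem i vs))) x))"
    by (simp add: sum_distrib_left sum_negf)
  \<comment> \<open>Omitting the leading b leaves vs and yields the Laplacian term. Omitting an
    entry of vs has its index shifted by one, and this sign change is what cancels the mixed
    terms.\<close>
  have ext_Cons: "(\<lambda>y. ext_deriv \<omega> y (b # vs)) =
      (\<lambda>y. dir_deriv b (W vs) y +
        (\<Sum>i<length vs. (- ((-1) ^ i)) * dir_deriv (vs ! i) (W (b # rem i vs)) y))" for b
    unfolding ext by (simp add: rem_def sum.lessThan_Suc_shift del: sum.lessThan_Suc)
  have "codiff (ext_deriv \<omega>) x vs = - (\<Sum>b\<in>Basis. dir_deriv b (\<lambda>y. ext_deriv \<omega> y (b # vs)) x)"
    by (simp add: codiff_def dir_deriv_def)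
  also have "\<dots> = - (\<Sum>b\<in>Basis. dir_deriv b (dir_deriv b (W vs)) x +
      (\<Sum>i<length vs. - ((-1) ^ i) * dir_deriv b (dir_deriv (vs ! i) (W (b # rem i vs))) x))"
    unfolding ext_Cons
    by (subst dir_deriv_add, simp, simp, subst dir_deriv_sum, simp, subst dir_deriv_cmult, simp, simp)
  also have "\<dots> = laplacian (W vs) x + (\<Sum>i<length vs. \<Sum>b\<in>Basis.
      (-1) ^ i * dir_deriv b (dir_deriv (vs ! i) (W (b # rem i vs))) x)"
    by (subst sum.swap) (simp add: laplacian_def sum.distrib sum_negf sum_subtractf)
  also have "(\<Sum>i<length vs. \<Sum>b\<in>Basis.
      (-1) ^ i * dir_deriv b (dir_deriv (vs ! i) (W (b # rem i vs))) x) =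
    (\<Sum>i<length vs. \<Sum>b\<in>Basis.
      (-1) ^ i * dir_deriv (vs ! i) (dir_deriv b (W (b # rem i vs))) x)"
    by (intro sum.cong refl arg_cong2[where f = "(*)"] dir_deriv_commute sW)
  finally show ?thesis
    unfolding hodge_laplacian_def using 1 by (simp add: sum_negf W_def)
qed

section \<open>Alternating forms in coordinates\<close>

lemma alternating_form_Cons:
  fixes v :: "'a::euclidean_space"
  assumes "alternating_form (Suc p) \<alpha>"
  shows "alternating_form p (\<lambda>vs. \<alpha> (v # vs))"
  unfolding alternating_form_def
proof (intro conjI allI impI)
  fix vs :: "'a list" and i assume "length vs = p" "i < p"
  then have "linear (\<lambda>w. \<alpha> ((v # vs)[Suc i := w]))"
    using assms unfolding alternating_form_def by (metis Suc_less_eq length_Cons)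
  then show "linear (\<lambda>w. \<alpha> (v # vs[i := w]))" by simp
qed (use assms in \<open>auto simp: alternating_form_def\<close>)

lemma alternating_form_linear_hd:
  assumes "alternating_form (Suc (length vs)) \<alpha>"
  shows "linear (\<lambda>v. \<alpha> (v # vs))"
proof -
  have "linear (\<lambda>v. \<alpha> ((undefined # vs)[0 := v]))"
    using assms unfolding alternating_form_def by (metis length_Cons zero_less_Suc)
  then show ?thesis by simp
qed

text \<open>Polarization: expand the vanishing value on v + w, v + w. The definition only demands
  vanishing on lists with a repetition, so antisymmetry has to be derived.\<close>

lemma alternating_form_swap:
  assumes "alternating_form p \<alpha>"
  shows "\<alpha> (v # w # vs) = - \<alpha> (w # v # vs)"
proof (cases "p = Suc (Suc (length vs))")
  case True
  have A: "linear (\<lambda>u. \<alpha> (u # w # vs))" for w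
    using assms True alternating_form_linear_hd[of "w # vs" \<alpha>] by simp
  have B: "linear (\<lambda>u. \<alpha> (w # u # vs))" for w
    using assms True alternating_form_linear_hd[OF alternating_form_Cons] by blast
  have Z: "\<alpha> (u # u # vs) = 0" for u
    using assms True by (simp add: alternating_form_def)
  have "0 = \<alpha> ((v + w) # (v + w) # vs)" by (rule Z[symmetric])
  also have "\<dots> = \<alpha> (v # w # vs) + \<alpha> (w # v # vs)"
    using Z[of v] Z[of w] by (simp add: linear_add[OF A] linear_add[OF B])
  finally show ?thesis by simp
next
  case False
  then show ?thesis using assms by (simp add: alternating_form_def)
qed

text \<open>Each step of the insertion swaps two neighbours and so only changes the sign. Tracking
  vanishing instead of the value spares the sign of the sorting permutation.\<close>

lemma alternating_form_insort_eq_0_iff: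
  assumes "alternating_form p \<alpha>"
  shows "\<alpha> (map e (insort a xs)) = 0 \<longleftrightarrow> \<alpha> (map e (a # xs)) = 0"
  using assms
proof (induction xs arbitrary: \<alpha> p)
  case (Cons x xs)
  show ?case
  proof (cases p)
    case 0
    then show ?thesis using Cons.prems by (simp add: alternating_form_def)
  next
    case (Suc q)
    show ?thesis
      using Cons.IH[OF alternating_form_Cons[of q \<alpha> "e x"]] Cons.prems
        alternating_form_swap[OF Cons.prems, of "e a" "e x" "map e xs"] by (simp add: Suc)
  qed
qed simp

lemma alternating_form_sort_eq_0_iff:
  assumes "alternating_form p \<alpha>"
  shows "\<alpha> (map e (sort xs)) = 0 \<longleftrightarrow> \<alpha> (map e xs) = 0"
  using assms
proof (induction xs arbitrary: \<alpha> p)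
  case (Cons x xs)
  show ?case
  proof (cases p)
    case 0
    then show ?thesis using Cons.prems by (simp add: alternating_form_def)
  next
    case (Suc q)
    show ?thesis
      using Cons.IH[OF alternating_form_Cons[of q \<alpha> "e x"]] Cons.prems
        alternating_form_insort_eq_0_iff[OF Cons.prems, of e x "sort xs"] by (simp add: Suc)
  qed
qed simp

section \<open>Components on increasing lists of basis vectors\<close>

definition basis_list :: "'n::{finite,linorder} set \<Rightarrow> (real, 'n) vec list" where
  "basis_list I = map (\<lambda>i. axis i 1) (sorted_list_of_set I)"

lemma length_basis_list [simp]: "length (basis_list I) = card I"
  by (simp add: basis_list_def)

text \<open>Multilinearity: the head of the list is expanded in the standard basis, and the form
  with that head fixed has degree one less.\<close>

lemma alternating_form_eq_0_if_index_lists: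
  fixes \<alpha> :: "(real, 'n::finite) vec list \<Rightarrow> real"
  assumes "alternating_form p \<alpha>"
    and "\<And>xs. length xs = p \<Longrightarrow> \<alpha> (map (\<lambda>i. axis i 1) xs) = 0"
  shows "\<alpha> vs = 0"
proof (cases "length vs = p")
  case True
  then show ?thesis using assms
  proof (induction vs arbitrary: p \<alpha>)
    case Nil
    then show ?case by (metis list.map_disc_iff list.size(3))
  next
    case (Cons v vs)
    have lin: "linear (\<lambda>v. \<alpha> (v # vs))"
      using Cons.prems by (intro alternating_form_linear_hd) simp
    have "\<alpha> (axis i 1 # vs) = 0" for i
    proof (rule Cons.IH[of "length vs" "\<lambda>vs. \<alpha> (axis i 1 # vs)"])
      show "alternating_form (length vs) (\<lambda>vs. \<alpha> (axis i 1 # vs))"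
        using Cons.prems by (intro alternating_form_Cons) simp
      show "\<alpha> (axis i 1 # map (\<lambda>i. axis i 1) xs) = 0" if "length xs = length vs" for xs
        using Cons.prems(1) Cons.prems(3)[of "i # xs"] that by simp
    qed simp
    moreover have "v = (\<Sum>i\<in>UNIV. v $ i *\<^sub>R axis i 1)"
      using basis_expansion[of v] by (simp add: scalar_mult_eq_scaleR)
    then have "\<alpha> (v # vs) = \<alpha> ((\<Sum>i\<in>UNIV. v $ i *\<^sub>R axis i 1) # vs)" by simp
    then have "\<alpha> (v # vs) = (\<Sum>i\<in>UNIV. v $ i *\<^sub>R \<alpha> (axis i 1 # vs))"
      by (simp add: linear_sum[OF lin] linear_scale[OF lin])
    ultimately show ?case by simp
  qed
qed (use assms in \<open>simp add: alternating_form_def\<close>)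

text \<open>A list of basis vectors with a repetition gives zero by alternation; one without can be
  sorted without affecting vanishing, and is then the increasing list of its index set.\<close>

lemma alternating_form_eq_0:
  fixes \<alpha> :: "(real, 'n::{finite,linorder}) vec list \<Rightarrow> real"
  assumes \<alpha>: "alternating_form p \<alpha>" and "\<And>I. card I = p \<Longrightarrow> \<alpha> (basis_list I) = 0"
  shows "\<alpha> vs = 0"
proof (rule alternating_form_eq_0_if_index_lists[OF \<alpha>])
  fix xs :: "'n list"
  assume "length xs = p"
  show "\<alpha> (map (\<lambda>i. axis i 1) xs) = 0"
  proof (cases "distinct xs")
    case True
    then have "\<alpha> (map (\<lambda>i. axis i 1) (sort xs)) = 0"
      using assms(2)[of "set xs"] \<open>length xs = p\<close>
      by (simp add: basis_list_def distinct_card sorted_list_of_set_sort_remdups distinct_remdups_id)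
    then show ?thesis using alternating_form_sort_eq_0_iff[OF \<alpha>] by blast
  next
    case False
    then have "\<not> distinct (map (\<lambda>i. axis i (1::real)) xs)" by (auto simp: distinct_map)
    then show ?thesis using \<alpha> \<open>length xs = p\<close> by (simp add: alternating_form_def)
  qed
qed

lemma alternating_form_diff:
  "alternating_form p \<alpha> \<Longrightarrow> alternating_form p \<beta> \<Longrightarrow> alternating_form p (\<lambda>vs. \<alpha> vs - \<beta> vs)"
  by (auto simp: alternating_form_def intro: linear_compose_sub)

lemma alternating_form_cmult:
  "alternating_form p \<alpha> \<Longrightarrow> alternating_form p (\<lambda>vs. c * \<alpha> vs)"
  using linear_compose_scale_right[of _ c] by (auto simp: alternating_form_def real_scaleR_def[symmetric] simp del: real_scaleR_def)

lemma alternating_form_sum: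
  "(\<And>i. i \<in> I \<Longrightarrow> alternating_form p (\<alpha> i)) \<Longrightarrow> alternating_form p (\<lambda>vs. \<Sum>i\<in>I. \<alpha> i vs)"
  by (auto simp: alternating_form_def intro: linear_compose_sum)

lemma alternating_form_eqI:
  fixes \<alpha> \<beta> :: "(real, 'n::{finite,linorder}) vec list \<Rightarrow> real"
  assumes "alternating_form p \<alpha>" "alternating_form p \<beta>"
    and "\<And>I. card I = p \<Longrightarrow> \<alpha> (basis_list I) = \<beta> (basis_list I)"
  shows "\<alpha> = \<beta>"
  using alternating_form_eq_0[OF alternating_form_diff[OF assms(1,2)]] assms(3) by (auto simp: fun_eq_iff)

lemma alternating_form_scaled_list:
  assumes "alternating_form (length xs) \<alpha>"
  shows "\<alpha> (map (\<lambda>i. s i *\<^sub>R e i) xs) = prod_list (map s xs) * \<alpha> (map e xs)"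
  using assms
proof (induction xs arbitrary: \<alpha>)
  case (Cons x xs)
  have "\<alpha> (map (\<lambda>i. s i *\<^sub>R e i) (x # xs)) = s x * \<alpha> (e x # map (\<lambda>i. s i *\<^sub>R e i) xs)"
    using linear_scale[OF alternating_form_linear_hd, of "map (\<lambda>i. s i *\<^sub>R e i) xs" \<alpha>] Cons.prems by simp
  also have "\<alpha> (e x # map (\<lambda>i. s i *\<^sub>R e i) xs) = prod_list (map s xs) * \<alpha> (e x # map e xs)"
    using Cons.prems by (intro Cons.IH alternating_form_Cons) simp
  finally show ?case by simp
qed simp

text \<open>In the usual notation \<open>dx\<^bsub>i\<^sub>1\<^esub> \<and> \<dots> \<and> dx\<^bsub>i\<^sub>p\<^esub>\<close> for \<open>I = {i\<^sub>1 < \<dots> < i\<^sub>p}\<close>.\<close>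

definition elementary_form :: "'n::{finite,linorder} set \<Rightarrow> (real, 'n) vec list \<Rightarrow> real" where
  "elementary_form I vs =
     (if length vs = card I
      then \<Sum>\<sigma> | \<sigma> permutes {..<card I}.
             of_int (sign \<sigma>) * (\<Prod>j<card I. vs ! j $ (sorted_list_of_set I ! \<sigma> j))
      else 0)"

text \<open>The value is a minor of the coordinate matrix of vs. Each summand contains exactly one
  factor from the i-th vector, whence linearity. If two vectors agree, composing with their
  transposition reverses every sign and keeps every product, so the sum equals its own
  negative.\<close>

lemma alternating_form_elementary_form: "alternating_form (card I) (elementary_form I)"
  unfolding alternating_form_def
proof (intro conjI allI impI)
  fix vs :: "(real, 'a) vec list" and i
  assume vs: "length vs = card I" and i: "i < card I"
  have split: "(\<Prod>j<card I. vs[i := v] ! j $ (l ! \<sigma> j)) =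
      v $ (l ! \<sigma> i) * (\<Prod>j\<in>{..<card I} - {i}. vs ! j $ (l ! \<sigma> j))" for v l \<sigma>
  proof -
    have "(\<Prod>j<card I. vs[i := v] ! j $ (l ! \<sigma> j)) =
        vs[i := v] ! i $ (l ! \<sigma> i) * (\<Prod>j\<in>{..<card I} - {i}. vs[i := v] ! j $ (l ! \<sigma> j))"
      using i by (intro prod.remove) auto
    then show ?thesis using vs i by simp
  qed
  show "linear (\<lambda>v. elementary_form I (vs[i := v]))"
    unfolding elementary_form_def using vs
    by (intro linearI) (simp_all add: split algebra_simps sum.distrib sum_distrib_left)
next
  fix vs :: "(real, 'a) vec list"
  assume vs: "length vs = card I" and "\<not> distinct vs"
  then obtain a b where ab: "a < card I" "b < card I" "a \<noteq> b" "vs ! a = vs ! b"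
    by (auto simp: distinct_conv_nth)
  define t where "t = Transposition.transpose a b"
  have t: "t permutes {..<card I}" using ab by (auto simp: t_def intro: permutes_swap_id)
  have vt: "vs ! t j = vs ! j" for j using ab by (auto simp: t_def Transposition.transpose_def)
  define f where "f \<sigma> = of_int (sign \<sigma>) * (\<Prod>j<card I. vs ! j $ (sorted_list_of_set I ! \<sigma> j))" for \<sigma>
  have "f (\<sigma> \<circ> t) = - f \<sigma>" if \<sigma>: "\<sigma> permutes {..<card I}" for \<sigma>
  proof -
    have "permutation \<sigma>" "permutation t"
      using \<sigma> t by (auto intro: permutes_imp_permutation[of "{..<card I}"])
    moreover have "sign t = -1" using ab by (simp add: t_def sign_swap_id)
    moreover have "(\<Prod>j<card I. vs ! t j $ (sorted_list_of_set I ! \<sigma> (t j))) =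
        (\<Prod>j<card I. vs ! j $ (sorted_list_of_set I ! \<sigma> j))"
      by (rule prod.permute[OF t, unfolded o_def, symmetric])
    ultimately show ?thesis by (simp add: f_def sign_compose vt)
  qed
  then have "sum f {\<sigma>. \<sigma> permutes {..<card I}} = - sum f {\<sigma>. \<sigma> permutes {..<card I}}"
    by (subst sum_permutations_compose_right[OF t]) (simp add: sum_negf)
  then show "elementary_form I vs = 0" using vs by (simp add: elementary_form_def f_def)
qed (simp add: elementary_form_def)

text \<open>A nonzero product forces the permutation to match the two increasing lists entry by
  entry. Then J is contained in I, equal cardinalities give J = I, and distinctness of the entries
  leaves only the identity.\<close>

lemma elementary_form_basis_list:
  assumes "card J = card I"
  shows "elementary_form I (basis_list J) = (if J = I then 1 else 0)"
proof -
  let ?l = "\<lambda>I. sorted_list_of_set I"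
  have entry: "basis_list J ! j $ i = (if ?l J ! j = i then 1 else 0)" if "j < card I" for i j
    using that assms by (simp add: basis_list_def axis_def)
  have summand: "(\<Prod>j<card I. basis_list J ! j $ (?l I ! \<sigma> j)) = (if J = I \<and> \<sigma> = id then 1 else 0)"
    if \<sigma>: "\<sigma> permutes {..<card I}" for \<sigma>
  proof (cases "\<forall>j<card I. ?l J ! j = ?l I ! \<sigma> j")
    case True
    have "J \<subseteq> I"
    proof
      fix i assume "i \<in> J"
      then have "i \<in> set (?l J)" by simp
      then obtain j where "j < card I" "i = ?l J ! j" using assms unfolding in_set_conv_nth by auto
      then have "i = ?l I ! \<sigma> j" "\<sigma> j < length (?l I)" using True permutes_in_image[OF \<sigma>, of j] by auto
      then show "i \<in> I" by (metis finite nth_mem set_sorted_list_of_set)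
    qed
    then have "J = I" using assms by (intro card_subset_eq) auto
    have "\<sigma> j = j" for j
    proof (cases "j < card I")
      case j: True
      then have "?l I ! j = ?l I ! \<sigma> j" "\<sigma> j < card I"
        using True \<open>J = I\<close> permutes_in_image[OF \<sigma>, of j] by auto
      then show ?thesis using j nth_eq_iff_index_eq[of "?l I" j "\<sigma> j"] by simp
    qed (use \<sigma> in \<open>auto simp: permutes_def\<close>)
    then have "\<sigma> = id" by auto
    then show ?thesis using \<open>J = I\<close> entry by simp
  next
    case False
    then obtain j where "j < card I" "?l J ! j \<noteq> ?l I ! \<sigma> j" by blast
    then have "(\<Prod>j<card I. basis_list J ! j $ (?l I ! \<sigma> j)) = 0"
      using entry by (intro prod_zero) auto
    then show ?thesis using False by auto
  qed
  have "elementary_form I (basis_list J) = (\<Sum>\<sigma> | \<sigma> permutes {..<card I}.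
      of_int (sign \<sigma>) * (if J = I \<and> \<sigma> = id then 1 else 0))"
    using assms summand by (simp add: elementary_form_def)
  also have "\<dots> = (\<Sum>\<sigma> | \<sigma> permutes {..<card I}. if \<sigma> = id then (if J = I then 1 else 0) else 0)"
    by (intro sum.cong) (auto simp: sign_id)
  also have "\<dots> = (if J = I then 1 else 0)"
    using finite_permutations[of "{..<card I}"] by (simp add: permutes_id)
  finally show ?thesis .
qed

text \<open>The form with coefficient functions c_I in the basis dx_I; on p-forms this inverts
  reading off the values at \<open>basis_list I\<close>.\<close>

definition form_of :: "nat \<Rightarrow> ('n set \<Rightarrow> (real, 'n) vec \<Rightarrow> real) \<Rightarrow> (real, 'n::{finite,linorder}) vec dform"
  where "form_of p c = (\<lambda>x vs. \<Sum>I | card I = p. c I x * elementary_form I vs)"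

lemma alternating_form_form_of: "alternating_form p (form_of p c x)"
  unfolding form_of_def
  by (intro alternating_form_sum alternating_form_cmult) (auto intro: alternating_form_elementary_form)

lemma form_of_basis_list:
  assumes "card J = p"
  shows "form_of p c x (basis_list J) = c J x"
proof -
  have "form_of p c x (basis_list J) = (\<Sum>I | card I = p. if I = J then c J x else 0)"
    unfolding form_of_def using assms by (intro sum.cong) (auto simp: elementary_form_basis_list)
  then show ?thesis using assms by simp
qed

lemma form_of_components:
  assumes "\<And>x. alternating_form p (\<omega> x)"
  shows "form_of p (\<lambda>I x. \<omega> x (basis_list I)) = \<omega>"
  by (rule ext, rule alternating_form_eqI[OF alternating_form_form_of assms])
    (rule form_of_basis_list)

lemma form_of_cong:
  "(\<And>I. card I = p \<Longrightarrow> c I = c' I) \<Longrightarrow> form_of p c = form_of p c'"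
  unfolding form_of_def by (intro ext sum.cong) auto

lemma smooth_form_form_of:
  "(\<And>I. card I = p \<Longrightarrow> smooth_function (c I)) \<Longrightarrow> smooth_form p (form_of p c)"
  unfolding smooth_form_def
  using alternating_form_form_of[of p c]
  by (auto simp: form_of_def mult.commute[of _ "elementary_form _ _"]
      intro!: smooth_function_sum smooth_function_cmult)

lemma laplacian_form_of:
  assumes "\<And>I. card I = p \<Longrightarrow> smooth_function (c I)"
  shows "laplacian (\<lambda>x. form_of p c x vs) x = form_of p (\<lambda>I. laplacian (c I)) x vs"
  unfolding form_of_def mult.commute[of _ "elementary_form _ _"] using assms
  by (subst laplacian_sum) (auto simp: laplacian_cmult smooth_function_cmult)

section \<open>The groups\<close>

lemma coord_number_bij: "bij_betw coord_number (UNIV :: 'n::{finite,linorder} set) {1..CARD('n)}"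
proof -
  have "strict_mono (coord_number :: 'n \<Rightarrow> nat)"
    unfolding coord_number_def by (intro strict_monoI psubset_card_mono) (auto simp: less_le_not_le)
  then have inj: "inj (coord_number :: 'n \<Rightarrow> nat)" by (rule strict_mono_imp_inj_on)
  have "coord_number i \<in> {1..CARD('n)}" for i :: 'n
  proof -
    have "card {j. j \<le> i} > 0" by (subst card_gt_0_iff) auto
    moreover have "card {j. j \<le> i} \<le> CARD('n)" by (intro card_mono) auto
    ultimately show ?thesis by (simp add: coord_number_def)
  qed
  then have "range (coord_number :: 'n \<Rightarrow> nat) \<subseteq> {1..CARD('n)}" by auto
  moreover have "card (range (coord_number :: 'n \<Rightarrow> nat)) = CARD('n)"
    using inj by (rule card_image)
  ultimately have "range (coord_number :: 'n \<Rightarrow> nat) = {1..CARD('n)}"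
    by (intro card_subset_eq) auto
  with inj show ?thesis by (simp add: bij_betw_def)
qed

text \<open>Makes k the true number of reflected coordinates, which links the reflection to the
  argument of the Krawtchouk polynomial, to the count 2^k and to the parity of k.\<close>

lemma card_coord_number_le:
  assumes "k \<le> CARD('n)"
  shows "card {i :: 'n::{finite,linorder}. coord_number i \<le> k} = k"
proof -
  have "coord_number ` {i :: 'n. coord_number i \<le> k} = {1..k}"
  proof
    show "{1..k} \<subseteq> coord_number ` {i :: 'n. coord_number i \<le> k}"
    proof
      fix m assume m: "m \<in> {1..k}"
      then have "m \<in> range (coord_number :: 'n \<Rightarrow> nat)"
        using coord_number_bij[where 'n='n] assms by (auto simp: bij_betw_def)
      then show "m \<in> coord_number ` {i :: 'n. coord_number i \<le> k}" using m by auto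
    qed
  next
    show "coord_number ` {i :: 'n. coord_number i \<le> k} \<subseteq> {1..k}"
      using coord_number_bij[where 'n='n] by (auto simp: bij_betw_def)
  qed
  moreover have "inj_on coord_number {i :: 'n. coord_number i \<le> k}"
    using coord_number_bij[where 'n='n] by (auto simp: bij_betw_def intro: inj_on_subset)
  ultimately have "card {1..k} = card {i :: 'n. coord_number i \<le> k}" by (metis card_image)
  then show ?thesis by simp
qed

lemma reflect_first_nth: "reflect_first k x $ i = (if coord_number i \<le> k then - (x $ i) else x $ i)"
  by (simp add: reflect_first_def)

lemma reflect_first_involution [simp]: "reflect_first k (reflect_first k x) = x"
  by (simp add: vec_eq_iff reflect_first_nth)

lemma linear_reflect_first: "linear (reflect_first k)"
  by (intro linearI) (simp_all add: vec_eq_iff reflect_first_nth)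

lemma reflect_first_add: "reflect_first k (x + y) = reflect_first k x + reflect_first k y"
  by (simp add: vec_eq_iff reflect_first_nth)

lemma reflect_first_axis:
  "reflect_first k (axis i c) = (if coord_number i \<le> k then -1 else 1) *\<^sub>R axis i c"
  by (simp add: vec_eq_iff reflect_first_nth axis_def)

lemma orthogonal_reflect_first: "orthogonal_transformation (reflect_first k)"
  unfolding orthogonal_transformation_def inner_vec_def
  by (intro conjI linear_reflect_first allI sum.cong refl) (simp add: reflect_first_nth)

lemma reflect_first_in_Ints:
  assumes "\<forall>i. b $ i \<in> \<int>"
  shows "reflect_first k b $ i \<in> \<int>"
  using spec[OF assms, of i] by (simp add: reflect_first_nth)

lemma O_group_eq_M_group: "O_group k = M_group k 0"
proof -
  have "reflect_first k \<circ> translation 0 = (reflect_first k :: (real, 'a) vec \<Rightarrow> _)"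
    by (simp add: fun_eq_iff translation_def)
  then show ?thesis by (simp add: O_group_def M_group_def)
qed

text \<open>Unlike \<open>half_vector\<close>, this admits a = 0, so that facts about
  \<open>M_group\<close> also cover \<open>O_group\<close>.\<close>

definition half_integral :: "(real, 'n::finite) vec \<Rightarrow> bool" where
  "half_integral a \<longleftrightarrow> (\<forall>i. 2 * a $ i \<in> \<int>)"

text \<open>The square of \<open>\<gamma>\<^sub>k \<circ> L\<^sub>a\<close> is the translation by \<open>a + \<gamma>\<^sub>k a\<close>.\<close>

lemma reflect_add_reflect_in_Ints:
  assumes "half_integral a"
  shows "(a + reflect_first k a) $ i \<in> \<int>"
  using spec[OF assms[unfolded half_integral_def], of i] by (simp add: reflect_first_nth)

text \<open>The lattice is normalized by rho and contains the translation rho^2, so the generated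
  group consists of just two cosets of the lattice. These two cosets form a subgroup that contains
  the generators, and each of their elements is a product of generators.\<close>

lemma mem_M_group_iff:
  fixes a :: "(real, 'n::{finite,linorder}) vec"
  assumes a: "half_integral a"
  shows "f \<in> M_group k a \<longleftrightarrow> (\<exists>b. (\<forall>i. b $ i \<in> \<int>) \<and>
           (f = (\<lambda>x. x + b) \<or> f = (\<lambda>x. reflect_first k (x + a) + b)))"
proof -
  let ?G = "motion_group :: ((real, 'n) vec \<Rightarrow> (real, 'n) vec) monoid"
  let ?S = "insert (reflect_first k \<circ> translation a) lattice_translations"
  let ?T = "\<lambda>b. (\<lambda>x. x + b)" and ?R = "\<lambda>b. (\<lambda>x. reflect_first k (x + a) + b)"
  let ?H = "{f. \<exists>b. (\<forall>i. b $ i \<in> \<int>) \<and> (f = ?T b \<or> f = ?R b)}"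
  interpret group ?G by (rule group_motion_group)
  have mult: "f \<otimes>\<^bsub>?G\<^esub> g = f \<circ> g" for f g by (simp add: motion_group_def)
  have T_in: "?T b \<in> ?H" and R_in: "?R b \<in> ?H" if "\<forall>i. b $ i \<in> \<int>" for b
    using that by blast+
  have one: "\<one>\<^bsub>?G\<^esub> = id" by (simp add: motion_group_def)
  have T_carrier: "?T b \<in> carrier ?G" for b
    unfolding motion_group_def partial_object.simps mem_Collect_eq
    by (intro exI[of _ "\<lambda>x. x"] exI[of _ b]) (simp add: orthogonal_transformation_id)
  have "?R b = (\<lambda>x. reflect_first k x + (reflect_first k a + b))" for b
    by (simp add: fun_eq_iff reflect_first_add)
  then have R_carrier: "?R b \<in> carrier ?G" for b
    unfolding motion_group_def partial_object.simps mem_Collect_eq using orthogonal_reflect_first by metis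
  have "subgroup ?H ?G"
  proof (rule subgroupI)
    show "?H \<subseteq> carrier ?G" using T_carrier R_carrier by auto
    have "?T 0 \<in> ?H" by (rule T_in) simp
    then show "?H \<noteq> {}" by blast
  next
    fix f assume "f \<in> ?H"
    then obtain b where b: "\<forall>i. b $ i \<in> \<int>" and f: "f = ?T b \<or> f = ?R b" by auto
    \<comment> \<open>Solves \<open>?R c \<circ> ?R b = id\<close>: this composite is the
      translation by a + gamma_k a + gamma_k b + c.\<close>
    define c where "c = - (a + reflect_first k a) - reflect_first k b"
    have c: "\<forall>i. c $ i \<in> \<int>"
      unfolding c_def using reflect_add_reflect_in_Ints[OF a, of k] reflect_first_in_Ints[OF b, of k]
      by (metis Ints_diff Ints_minus vector_minus_component vector_uminus_component)
    from f show "inv\<^bsub>?G\<^esub> f \<in> ?H"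
    proof
      assume f: "f = ?T b"
      have "inv\<^bsub>?G\<^esub> f = ?T (- b)" unfolding f
        using T_carrier[of "- b"] by (intro inv_equality T_carrier) (auto simp: mult one fun_eq_iff)
      moreover have "\<forall>i. (- b) $ i \<in> \<int>" using b by simp
      ultimately show ?thesis by blast
    next
      assume f: "f = ?R b"
      have "inv\<^bsub>?G\<^esub> f = ?R c" unfolding f
      proof (rule inv_equality)
        show "?R c \<otimes>\<^bsub>?G\<^esub> ?R b = \<one>\<^bsub>?G\<^esub>"
          unfolding mult one by (simp add: fun_eq_iff reflect_first_add c_def)
      qed (rule R_carrier)+
      then show ?thesis using c by blast
    qed
  next
    fix f g assume "f \<in> ?H" "g \<in> ?H"
    then obtain b c where b: "\<forall>i. b $ i \<in> \<int>" and f: "f = ?T b \<or> f = ?R b"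
      and c: "\<forall>i. c $ i \<in> \<int>" and g: "g = ?T c \<or> g = ?R c" by auto
    have ints: "\<forall>i. (c + b) $ i \<in> \<int>" "\<forall>i. (reflect_first k c + b) $ i \<in> \<int>"
      using b c reflect_first_in_Ints[OF c, of k] by simp_all
    then have ints': "\<forall>i. (reflect_first k c + b + (a + reflect_first k a)) $ i \<in> \<int>"
      using reflect_add_reflect_in_Ints[OF a, of k] by (metis Ints_add vector_add_component)
    have "?T b \<circ> ?T c = ?T (c + b)" "?T b \<circ> ?R c = ?R (c + b)"
      "?R b \<circ> ?T c = ?R (reflect_first k c + b)"
      "?R b \<circ> ?R c = ?T (reflect_first k c + b + (a + reflect_first k a))"
      by (simp_all add: fun_eq_iff reflect_first_add)
    then have "?T b \<circ> ?T c \<in> ?H" "?T b \<circ> ?R c \<in> ?H" "?R b \<circ> ?T c \<in> ?H" "?R b \<circ> ?R c \<in> ?H"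
      using T_in[OF ints(1)] R_in[OF ints(1)] R_in[OF ints(2)] T_in[OF ints'] by presburger+
    then show "f \<otimes>\<^bsub>?G\<^esub> g \<in> ?H"
      unfolding mult using f g by (elim disjE) (simp_all only:)
  qed
  moreover have "?S \<subseteq> ?H"
  proof -
    have "reflect_first k \<circ> translation a = ?R 0" by (simp add: fun_eq_iff translation_def)
    moreover have "translation b = ?T b" for b by (simp add: fun_eq_iff translation_def)
    moreover have "?R 0 \<in> ?H" by (rule R_in) simp
    ultimately show ?thesis unfolding lattice_translations_def using T_in by auto
  qed
  ultimately have "generate ?G ?S \<subseteq> ?H" by (rule generate_subgroup_incl[rotated])
  moreover have "?H \<subseteq> generate ?G ?S"
  proof
    fix f assume "f \<in> ?H"
    then obtain b where b: "\<forall>i. b $ i \<in> \<int>" and f: "f = ?T b \<or> f = ?R b" by auto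
    have T: "?T b \<in> generate ?G ?S"
    proof (rule generate.incl)
      have "?T b = translation b" by (simp add: fun_eq_iff translation_def)
      then show "?T b \<in> ?S" using b by (auto simp: lattice_translations_def)
    qed
    have "?R b = ?T b \<otimes>\<^bsub>?G\<^esub> (reflect_first k \<circ> translation a)"
      by (simp add: mult fun_eq_iff translation_def)
    then have "?R b \<in> generate ?G ?S"
      using generate.eng[OF T generate.incl[of "reflect_first k \<circ> translation a" ?S]] by simp
    then show "f \<in> generate ?G ?S" using T f by auto
  qed
  ultimately have "M_group k a = ?H" unfolding M_group_def by blast
  then show ?thesis by simp
qed

lemma pullback_form_affine:
  assumes "linear A"
  shows "pullback_form (\<lambda>x. A x + c) \<omega> = (\<lambda>x vs. \<omega> (A x + c) (map A vs))"
proof -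
  have "((\<lambda>x. A x + c) has_derivative A) (at x)" for x
    using assms linear_conv_bounded_linear
    by (auto intro!: derivative_eq_intros bounded_linear_imp_has_derivative)
  then have "frechet_derivative (\<lambda>x. A x + c) (at x) = A" for x
    by (metis frechet_derivative_at)
  then show ?thesis by (simp add: pullback_form_def)
qed

text \<open>Translations have derivative the identity and rho has derivative gamma_k, so invariance
  reduces to periodicity and a single equation for rho.\<close>

lemma invariant_form_M_group_iff:
  fixes a :: "(real, 'n::{finite,linorder}) vec"
  assumes a: "half_integral a"
  shows "invariant_form (M_group k a) \<omega> \<longleftrightarrow>
     (\<forall>b. (\<forall>i. b $ i \<in> \<int>) \<longrightarrow> (\<forall>x. \<omega> (x + b) = \<omega> x)) \<and>
     (\<forall>x vs. \<omega> (reflect_first k (x + a)) (map (reflect_first k) vs) = \<omega> x vs)" (is "_ \<longleftrightarrow> ?T \<and> ?R")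
proof -
  have pT: "pullback_form (\<lambda>x. x + b) \<omega> = (\<lambda>x. \<omega> (x + b))" for b
    using pullback_form_affine[OF linear_id, of b \<omega>] by (simp add: id_def)
  have pR: "pullback_form (\<lambda>x. reflect_first k (x + a) + b) \<omega> =
      (\<lambda>x vs. \<omega> (reflect_first k (x + a) + b) (map (reflect_first k) vs))" for b
    using pullback_form_affine[OF linear_reflect_first, of k "reflect_first k a + b" \<omega>]
    by (simp add: reflect_first_add add.assoc)
  show ?thesis
  proof (intro iffI conjI)
    assume inv: "invariant_form (M_group k a) \<omega>"
    show ?T
      using inv pT unfolding invariant_form_def by (metis mem_M_group_iff[OF a])
    have "(\<lambda>x. reflect_first k (x + a) + 0) \<in> M_group k a"
      unfolding mem_M_group_iff[OF a] by (intro exI[of _ 0]) simp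
    then have "pullback_form (\<lambda>x. reflect_first k (x + a) + 0) \<omega> = \<omega>"
      using inv unfolding invariant_form_def by blast
    then show ?R unfolding pR by (simp add: fun_eq_iff)
  next
    assume *: "?T \<and> ?R"
    show "invariant_form (M_group k a) \<omega>"
      unfolding invariant_form_def
    proof
      fix f assume "f \<in> M_group k a"
      then obtain b where b: "\<forall>i. b $ i \<in> \<int>"
        and "f = (\<lambda>x. x + b) \<or> f = (\<lambda>x. reflect_first k (x + a) + b)"
        unfolding mem_M_group_iff[OF a] by blast
      then show "pullback_form f \<omega> = \<omega>" using * by (auto simp: pT pR)
    qed
  qed
qed

section \<open>Eigenforms in components\<close>

text \<open>The eigenspace of functions on the flat torus R^d / Z^d, shared by all the
  groups.\<close>

definition periodic_eigenfunctions :: "real \<Rightarrow> ((real, 'n::finite) vec \<Rightarrow> real) set" where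
  "periodic_eigenfunctions \<mu> = {f. smooth_function f \<and>
     (\<forall>b x. (\<forall>i. b $ i \<in> \<int>) \<longrightarrow> f (x + b) = f x) \<and> (\<forall>x. laplacian f x = \<mu> * f x)}"

text \<open>The factor by which pulling back along gamma_k multiplies dx_I.\<close>

definition reflection_sign :: "nat \<Rightarrow> 'n::{finite,linorder} set \<Rightarrow> real" where
  "reflection_sign k I = (-1) ^ card {i \<in> I. coord_number i \<le> k}"

lemma reflection_sign_cases: "reflection_sign k I = 1 \<or> reflection_sign k I = -1"
  by (simp add: reflection_sign_def minus_one_power_iff)

lemma alternating_form_reflect_basis_list:
  assumes "alternating_form (card I) \<alpha>"
  shows "\<alpha> (map (reflect_first k) (basis_list I)) = reflection_sign k I * \<alpha> (basis_list I)"
proof -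
  let ?s = "\<lambda>i. if coord_number i \<le> k then -1 else (1::real)"
  have "\<alpha> (map (reflect_first k) (basis_list I)) =
      prod_list (map ?s (sorted_list_of_set I)) * \<alpha> (basis_list I)"
    using alternating_form_scaled_list[of "sorted_list_of_set I" \<alpha> ?s "\<lambda>i. axis i 1"] assms
    by (simp add: basis_list_def o_def reflect_first_axis)
  also have "prod_list (map ?s (sorted_list_of_set I)) = prod ?s I"
    by (simp add: prod.distinct_set_conv_list[symmetric])
  also have "\<dots> = reflection_sign k I"
    by (simp add: prod.If_cases reflection_sign_def Int_def)
  finally show ?thesis .
qed

lemma alternating_form_map:
  assumes "linear A" "alternating_form p \<alpha>"
  shows "alternating_form p (\<lambda>vs. \<alpha> (map A vs))"
proof -
  have "linear (\<lambda>v. \<alpha> ((map A vs)[i := A v]))" if "length vs = p" "i < p" for vs i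
    using linear_compose[OF assms(1), of "\<lambda>v. \<alpha> ((map A vs)[i := v])"] assms(2) that
    by (simp add: alternating_form_def o_def)
  then show ?thesis using assms(2) by (auto simp: alternating_form_def map_update distinct_map)
qed

text \<open>Both sides of the equation for rho are alternating, so it suffices to compare them on
  increasing basis lists. There the sign occurs twice, once from the reflected vectors and once from
  the coefficient, and squares to one.\<close>

lemma invariant_form_form_of:
  fixes a :: "(real, 'n::{finite,linorder}) vec"
  assumes a: "half_integral a"
    and per: "\<And>I b x. card I = p \<Longrightarrow> (\<forall>i. b $ i \<in> \<int>) \<Longrightarrow> c I (x + b) = c I x"
    and sign: "\<And>I x. card I = p \<Longrightarrow> c I (reflect_first k (x + a)) = reflection_sign k I * c I x"
  shows "invariant_form (M_group k a) (form_of p c)"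
proof -
  have "form_of p c (x + b) = form_of p c x" if "\<forall>i. b $ i \<in> \<int>" for x b
    unfolding form_of_def using per that by (intro ext sum.cong) auto
  moreover have "(\<lambda>vs. form_of p c (reflect_first k (x + a)) (map (reflect_first k) vs)) = form_of p c x"
    for x
  proof (rule alternating_form_eqI)
    fix I :: "'n set" assume I: "card I = p"
    have "form_of p c (reflect_first k (x + a)) (map (reflect_first k) (basis_list I)) =
        reflection_sign k I * form_of p c (reflect_first k (x + a)) (basis_list I)"
      using alternating_form_form_of I by (intro alternating_form_reflect_basis_list) blast
    also have "\<dots> = form_of p c x (basis_list I)"
      using reflection_sign_cases[of k I] I by (auto simp: form_of_basis_list sign)
    finally show "form_of p c (reflect_first k (x + a)) (map (reflect_first k) (basis_list I)) =
      form_of p c x (basis_list I)" .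
  qed (intro alternating_form_map alternating_form_form_of linear_reflect_first)+
  then have "form_of p c (reflect_first k (x + a)) (map (reflect_first k) vs) = form_of p c x vs" for x vs
    by (rule fun_cong)
  ultimately show ?thesis
    unfolding invariant_form_M_group_iff[OF a] by blast
qed

lemma form_of_in_eigenforms:
  fixes a :: "(real, 'n::{finite,linorder}) vec"
  assumes a: "half_integral a"
    and c: "\<And>I. card I = p \<Longrightarrow> c I \<in> periodic_eigenfunctions \<mu>"
    and sign: "\<And>I x. card I = p \<Longrightarrow> c I (reflect_first k (x + a)) = reflection_sign k I * c I x"
  shows "form_of p c \<in> eigenforms (M_group k a) p \<mu>"
proof -
  have smooth: "smooth_form p (form_of p c)"
    using c by (intro smooth_form_form_of) (simp add: periodic_eigenfunctions_def)
  have "invariant_form (M_group k a) (form_of p c)"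
    using c by (intro invariant_form_form_of a sign) (auto simp: periodic_eigenfunctions_def)
  moreover have "hodge_laplacian (form_of p c) = scale_form \<mu> (form_of p c)"
  proof (intro ext)
    fix x vs
    have "hodge_laplacian (form_of p c) x vs = form_of p (\<lambda>I. laplacian (c I)) x vs"
      using smooth c by (simp add: hodge_laplacian_eq smooth_form_def laplacian_form_of periodic_eigenfunctions_def)
    also have "\<dots> = form_of p (\<lambda>I x. \<mu> * c I x) x vs"
      using c by (subst form_of_cong[where c' = "\<lambda>I x. \<mu> * c I x"]) (auto simp: periodic_eigenfunctions_def)
    also have "\<dots> = scale_form \<mu> (form_of p c) x vs"
      by (simp add: form_of_def scale_form_def sum_distrib_left mult.assoc)
    finally show "hodge_laplacian (form_of p c) x vs = scale_form \<mu> (form_of p c) x vs" .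
  qed
  ultimately show ?thesis using smooth by (simp add: eigenforms_def)
qed

text \<open>The converse of \<open>form_of_in_eigenforms\<close>. The sign can be moved across the
  invariance equation because it is its own inverse.\<close>

lemma eigenforms_component:
  fixes a :: "(real, 'n::{finite,linorder}) vec"
  assumes a: "half_integral a" and \<omega>: "\<omega> \<in> eigenforms (M_group k a) p \<mu>"
  shows "(\<lambda>x. \<omega> x vs) \<in> periodic_eigenfunctions \<mu>"
    and "card I = p \<Longrightarrow> \<omega> (reflect_first k (x + a)) (basis_list I) = reflection_sign k I * \<omega> x (basis_list I)"
proof -
  have smooth: "smooth_form p \<omega>" and inv: "invariant_form (M_group k a) \<omega>"
    and ev: "hodge_laplacian \<omega> = scale_form \<mu> \<omega>"
    using \<omega> by (auto simp: eigenforms_def)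
  have "laplacian (\<lambda>x. \<omega> x vs) x = \<mu> * \<omega> x vs" for x
    using hodge_laplacian_eq[of \<omega> x vs] smooth ev by (simp add: smooth_form_def scale_form_def)
  then show "(\<lambda>x. \<omega> x vs) \<in> periodic_eigenfunctions \<mu>"
    using smooth inv unfolding invariant_form_M_group_iff[OF a]
    by (simp add: periodic_eigenfunctions_def smooth_form_def)
  assume I: "card I = p"
  have "\<omega> x (basis_list I) = \<omega> (reflect_first k (x + a)) (map (reflect_first k) (basis_list I))"
    using inv unfolding invariant_form_M_group_iff[OF a] by simp
  also have "\<dots> = reflection_sign k I * \<omega> (reflect_first k (x + a)) (basis_list I)"
    using smooth I by (intro alternating_form_reflect_basis_list) (simp add: smooth_form_def)
  finally show "\<omega> (reflect_first k (x + a)) (basis_list I) = reflection_sign k I * \<omega> x (basis_list I)"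
    using reflection_sign_cases[of k I] by auto
qed

lemma periodic_eigenfunctions_add:
  "f \<in> periodic_eigenfunctions \<mu> \<Longrightarrow> g \<in> periodic_eigenfunctions \<mu> \<Longrightarrow>
    (\<lambda>x. f x + g x) \<in> periodic_eigenfunctions \<mu>"
  by (simp add: periodic_eigenfunctions_def smooth_function_add laplacian_add distrib_left)

lemma periodic_eigenfunctions_cmult:
  "f \<in> periodic_eigenfunctions \<mu> \<Longrightarrow> (\<lambda>x. c * f x) \<in> periodic_eigenfunctions \<mu>"
  by (simp add: periodic_eigenfunctions_def smooth_function_cmult laplacian_cmult mult.left_commute)

text \<open>The reflection sends each standard basis vector to itself or to its negative, and in a
  second derivative this sign enters twice.\<close>

lemma laplacian_reflect:
  assumes "smooth_function f"
  shows "laplacian (\<lambda>x. f (reflect_first k x + c)) x = laplacian f (reflect_first k x + c)"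
proof -
  note diff = smooth_function_differentiable smooth_function_dir_deriv
  have "dir_deriv b (dir_deriv b (\<lambda>x. f (reflect_first k x + c))) x =
      dir_deriv b (dir_deriv b f) (reflect_first k x + c)" if basis: "b \<in> Basis" for b
  proof -
    obtain i where "b = axis i 1" using basis by (auto simp: Basis_vec_def)
    then have b: "reflect_first k b = b \<or> reflect_first k b = - b" by (simp add: reflect_first_axis)
    have neg: "dir_deriv (- b) g = (\<lambda>x. (- 1) * dir_deriv b g x)" if "smooth_function g" for g
      using dir_deriv_uminus_dir[OF smooth_function_differentiable[OF that]] by (simp add: fun_eq_iff)
    have "dir_deriv b (dir_deriv b (\<lambda>x. f (reflect_first k x + c))) x =
        dir_deriv (reflect_first k b) (dir_deriv (reflect_first k b) f) (reflect_first k x + c)"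
      by (subst dir_deriv_affine[OF _ linear_reflect_first], simp add: diff assms,
          subst dir_deriv_affine[OF _ linear_reflect_first], simp add: diff assms, rule refl)
    also have "\<dots> = dir_deriv b (dir_deriv b f) (reflect_first k x + c)"
      using b
    proof
      assume "reflect_first k b = - b"
      then show ?thesis
        using assms by (simp only: neg diff dir_deriv_cmult smooth_function_cmult)
    qed simp
    finally show ?thesis .
  qed
  then show ?thesis by (simp add: laplacian_def)
qed

lemma periodic_eigenfunctions_reflect:
  assumes f: "f \<in> periodic_eigenfunctions \<mu>"
  shows "(\<lambda>x. f (reflect_first k (x + a))) \<in> periodic_eigenfunctions \<mu>"
proof -
  have smooth: "smooth_function f" and per: "\<And>b x. (\<forall>i. b $ i \<in> \<int>) \<Longrightarrow> f (x + b) = f x"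
    and ev: "\<And>x. laplacian f x = \<mu> * f x"
    using f unfolding periodic_eigenfunctions_def by blast+
  have eq: "(\<lambda>x. f (reflect_first k (x + a))) = (\<lambda>x. f (reflect_first k x + reflect_first k a))"
    by (simp add: reflect_first_add)
  have "f (reflect_first k (x + b) + c) = f (reflect_first k x + c)" if "\<forall>i. b $ i \<in> \<int>" for b c x
    using per[of "reflect_first k b" "reflect_first k x + c"] reflect_first_in_Ints[OF that]
    by (simp add: reflect_first_add algebra_simps)
  then show ?thesis
    unfolding eq periodic_eigenfunctions_def mem_Collect_eq
    by (intro conjI allI impI smooth_function_affine linear_reflect_first smooth)
      (simp_all add: laplacian_reflect[OF smooth] ev)
qed

lemma periodic_eigenfunctions_reflect_involution:
  assumes "half_integral a" "f \<in> periodic_eigenfunctions \<mu>"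
  shows "f (reflect_first k (reflect_first k (x + a) + a)) = f x"
proof -
  have "reflect_first k (reflect_first k (x + a) + a) = x + (a + reflect_first k a)"
    by (simp add: reflect_first_add)
  then show ?thesis
    using assms(2) reflect_add_reflect_in_Ints[OF assms(1), of k]
    unfolding periodic_eigenfunctions_def by auto
qed

text \<open>The projection of \<open>f\<close> onto the \<open>s\<close>-eigenspace of the involution \<open>f \<mapsto> f \<circ> \<rho>\<^sub>k\<close>,
  where \<open>s = \<plusminus>1\<close>.\<close>

definition reflection_part ::
    "nat \<Rightarrow> (real, 'n::{finite,linorder}) vec \<Rightarrow> real \<Rightarrow> ((real, 'n) vec \<Rightarrow> real) \<Rightarrow> (real, 'n) vec \<Rightarrow> real" where
  "reflection_part k a s f = (\<lambda>x. (1 / 2) * (f x + s * f (reflect_first k (x + a))))"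

lemma reflection_part_periodic_eigenfunctions:
  "f \<in> periodic_eigenfunctions \<mu> \<Longrightarrow> reflection_part k a s f \<in> periodic_eigenfunctions \<mu>"
  unfolding reflection_part_def
  by (intro periodic_eigenfunctions_cmult periodic_eigenfunctions_add periodic_eigenfunctions_reflect)

lemma reflection_part_reflect:
  assumes "half_integral a" "f \<in> periodic_eigenfunctions \<mu>" "s = 1 \<or> s = -1"
  shows "reflection_part k a s f (reflect_first k (x + a)) = s * reflection_part k a s f x"
  using assms(3) by (auto simp: reflection_part_def periodic_eigenfunctions_reflect_involution[OF assms(1,2)])

lemma reflection_part_sum:
  "reflection_part k a 1 f x + reflection_part k a (- 1) f x = f x"
  by (simp add: reflection_part_def field_simps)

text \<open>This separates a sum of a symmetric and an antisymmetric function into its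
  summands.\<close>

lemma reflection_part_eigen:
  assumes "\<And>x. f (reflect_first k (x + a)) = t * f x" "s = 1 \<or> s = -1" "t = 1 \<or> t = -1"
  shows "reflection_part k a s f = (\<lambda>x. if s = t then f x else 0)"
  using assms(2,3) by (auto simp: reflection_part_def assms(1))

lemma reflection_part_add:
  "reflection_part k a s (\<lambda>x. f x + g x) = (\<lambda>x. reflection_part k a s f x + reflection_part k a s g x)"
  by (simp add: reflection_part_def algebra_simps)

lemma reflection_part_cmult:
  "reflection_part k a s (\<lambda>x. c * f x) = (\<lambda>x. c * reflection_part k a s f x)"
  by (simp add: reflection_part_def algebra_simps)

section \<open>Krawtchouk polynomials count subsets by parity\<close>

definition signed_subsets :: "nat \<Rightarrow> nat \<Rightarrow> real \<Rightarrow> 'n::{finite,linorder} set set" where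
  "signed_subsets p k s = {I. card I = p \<and> reflection_sign k I = s}"

text \<open>I is split into its part inside A and its part outside. The hypothesis keeps
  \<open>p - j\<close> from being truncated.\<close>

lemma card_subsets_Int:
  fixes A :: "'n::finite set"
  assumes "j \<le> p"
  shows "card {I. card I = p \<and> card (I \<inter> A) = j} = (card A choose j) * (card (- A) choose (p - j))"
proof -
  let ?P = "{B. B \<subseteq> A \<and> card B = j} \<times> {C. C \<subseteq> - A \<and> card C = p - j}"
  have "bij_betw (\<lambda>(B, C). B \<union> C) ?P {I. card I = p \<and> card (I \<inter> A) = j}"
  proof (rule bij_betw_byWitness[where f' = "\<lambda>I. (I \<inter> A, I - A)"])
    show "(\<lambda>(B, C). B \<union> C) ` ?P \<subseteq> {I. card I = p \<and> card (I \<inter> A) = j}"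
    proof clarify
      fix B C assume *: "B \<subseteq> A" "C \<subseteq> - A" "card C = p - card B" "j = card B"
      then have "(B \<union> C) \<inter> A = B" by auto
      moreover have "card (B \<union> C) = card B + card C" using * by (intro card_Un_disjoint) auto
      ultimately show "card (B \<union> C) = p \<and> card ((B \<union> C) \<inter> A) = card B" using * assms by simp
    qed
    show "(\<lambda>I. (I \<inter> A, I - A)) ` {I. card I = p \<and> card (I \<inter> A) = j} \<subseteq> ?P"
      by (auto simp: card_Diff_subset_Int)
  qed auto
  then have "card {I. card I = p \<and> card (I \<inter> A) = j} = card ?P"
    by (simp add: bij_betw_same_card)
  also have "\<dots> = (card A choose j) * (card (- A) choose (p - j))"
    by (simp add: card_cartesian_product n_subsets)
  finally show ?thesis .
qed

text \<open>Group the p-subsets by the number j of reflected coordinates they contain: each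
  contributes (-1)^j, and the product of the two binomial coefficients counts them.\<close>

lemma krawtchouk_eq_sum_reflection_sign:
  assumes "k \<le> CARD('n::{finite,linorder})"
  shows "krawtchouk CARD('n) p (real k) = (\<Sum>I :: 'n set | card I = p. reflection_sign k I)"
proof -
  define A where "A = {i :: 'n. coord_number i \<le> k}"
  have A: "card A = k" "card (- A) = CARD('n) - k"
    using card_coord_number_le[OF assms] by (simp_all add: A_def Compl_eq_Diff_UNIV card_Diff_subset)
  have "(\<Sum>I :: 'n set | card I = p. reflection_sign k I) =
      (\<Sum>I :: 'n set | card I = p. (-1) ^ card (I \<inter> A))"
    by (intro sum.cong) (auto simp: reflection_sign_def A_def Int_def)
  also have "\<dots> = (\<Sum>j\<in>{0..p}. \<Sum>I\<in>{I. I \<in> {I :: 'n set. card I = p} \<and> card (I \<inter> A) = j}. (-1) ^ card (I \<inter> A))"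
  proof (rule sum.group[symmetric])
    show "(\<lambda>I. card (I \<inter> A)) ` {I. card I = p} \<subseteq> {0..p}"
      by (auto intro!: card_mono)
  qed auto
  also have "\<dots> = (\<Sum>j\<in>{0..p}. (-1) ^ j * real ((k choose j) * ((CARD('n) - k) choose (p - j))))"
  proof (rule sum.cong)
    fix j assume "j \<in> {0..p}"
    then have "card {I. card I = p \<and> card (I \<inter> A) = j} = (k choose j) * ((CARD('n) - k) choose (p - j))"
      by (simp add: card_subsets_Int A)
    then show "(\<Sum>I\<in>{I. I \<in> {I :: 'n set. card I = p} \<and> card (I \<inter> A) = j}. (-1) ^ card (I \<inter> A)) =
        (-1) ^ j * real ((k choose j) * ((CARD('n) - k) choose (p - j)))" by simp
  qed simp
  \<comment> \<open>At the integer k the generalized binomial coefficients are ordinary ones; the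
    bound on k makes the real difference d - k the cast of the natural one.\<close>
  also have "\<dots> = krawtchouk CARD('n) p (real k)"
    using assms by (simp add: krawtchouk_def binomial_gbinomial of_nat_diff mult.assoc)
  finally show ?thesis by simp
qed

text \<open>The sum of the signs is the difference of the sizes of the two classes, which together
  exhaust the p-subsets. The common size does not involve k, so classes for different k can be
  matched.\<close>

lemma card_signed_subsets:
  assumes "k \<le> CARD('n)" "krawtchouk CARD('n) p (real k) = 0" "s = 1 \<or> s = -1"
  shows "card (signed_subsets p k s :: 'n::{finite,linorder} set set) = (CARD('n) choose p) div 2"
proof -
  let ?S = "\<lambda>s. signed_subsets p k s :: 'n set set"
  have union: "{I :: 'n set. card I = p} = ?S 1 \<union> ?S (- 1)" and disj: "?S 1 \<inter> ?S (- 1) = {}"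
    using reflection_sign_cases by (auto simp: signed_subsets_def)
  have "0 = (\<Sum>I\<in>?S 1 \<union> ?S (- 1). reflection_sign k I)"
    using krawtchouk_eq_sum_reflection_sign[OF assms(1), of p] assms(2) union by simp
  also have "\<dots> = (\<Sum>I\<in>?S 1. reflection_sign k I) + (\<Sum>I\<in>?S (- 1). reflection_sign k I)"
    using disj by (intro sum.union_disjoint) auto
  also have "\<dots> = real (card (?S 1)) - real (card (?S (- 1)))"
    by (simp add: signed_subsets_def)
  finally have "card (?S 1) = card (?S (- 1))" by simp
  moreover have "CARD('n) choose p = card {I :: 'n set. card I = p}"
    using n_subsets[of "UNIV :: 'n set" p] by simp
  then have "CARD('n) choose p = card (?S 1) + card (?S (- 1))"
    unfolding union using disj by (simp add: card_Un_disjoint)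
  ultimately show ?thesis using assms(3) by auto
qed

text \<open>An arbitrary numbering of each sign class; only its bijectivity is used. Equal numbers
  define the pairing of even with odd subsets.\<close>

definition subset_enum :: "nat \<Rightarrow> nat \<Rightarrow> real \<Rightarrow> nat \<Rightarrow> 'n::{finite,linorder} set" where
  "subset_enum p k s =
     (SOME h. bij_betw h {0..<card (signed_subsets p k s :: 'n set set)} (signed_subsets p k s))"

definition subset_index :: "nat \<Rightarrow> nat \<Rightarrow> 'n::{finite,linorder} set \<Rightarrow> nat" where
  "subset_index p k I =
     inv_into {0..<card (signed_subsets p k (reflection_sign k I) :: 'n set set)}
       (subset_enum p k (reflection_sign k I)) I"

lemma subset_enum_bij:
  "bij_betw (subset_enum p k s) {0..<card (signed_subsets p k s :: 'n set set)}
     (signed_subsets p k s :: 'n::{finite,linorder} set set)"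
  unfolding subset_enum_def by (rule someI_ex[OF ex_bij_betw_nat_finite]) simp

lemma subset_enum_index:
  fixes I :: "'n::{finite,linorder} set"
  assumes "card I = p"
  shows "subset_enum p k (reflection_sign k I) (subset_index p k I) = I"
    and "subset_index p k I < card (signed_subsets p k (reflection_sign k I) :: 'n set set)"
proof -
  let ?s = "reflection_sign k I"
  have bij: "bij_betw (subset_enum p k ?s) {0..<card (signed_subsets p k ?s :: 'n set set)}
     (signed_subsets p k ?s :: 'n set set)" by (rule subset_enum_bij)
  have I: "I \<in> signed_subsets p k ?s" using assms by (simp add: signed_subsets_def)
  then show "subset_enum p k ?s (subset_index p k I) = I"
    unfolding subset_index_def using bij by (intro f_inv_into_f) (simp add: bij_betw_def)
  show "subset_index p k I < card (signed_subsets p k ?s :: 'n set set)"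
    unfolding subset_index_def using bij I inv_into_into[of I "subset_enum p k ?s" "{0..<card (signed_subsets p k ?s :: 'n set set)}"]
    by (simp add: bij_betw_def)
qed

lemma subset_index_enum:
  assumes "n < card (signed_subsets p k s :: 'n set set)"
  shows "card (subset_enum p k s n :: 'n::{finite,linorder} set) = p"
    and "reflection_sign k (subset_enum p k s n :: 'n set) = s"
    and "subset_index p k (subset_enum p k s n :: 'n set) = n"
proof -
  let ?I = "subset_enum p k s n :: 'n set"
  have "?I \<in> signed_subsets p k s"
    using subset_enum_bij[of p k s, where 'n='n] assms by (auto simp: bij_betw_def)
  then show "card ?I = p" and s: "reflection_sign k ?I = s" by (auto simp: signed_subsets_def)
  show "subset_index p k ?I = n"
    unfolding subset_index_def s
    using subset_enum_bij[of p k s, where 'n='n] assms by (simp add: bij_betw_def)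
qed

section \<open>Isospectrality\<close>

text \<open>Pairing the \<open>n\<close>-th subsets of either sign, the components of an eigenform for \<open>M_group k a\<close>
  add up to a periodic eigenfunction without any symmetry condition, from which the two components
  are recovered as its parts of either sign. Composing this with the inverse of the analogous
  map for \<open>M_group k' a'\<close> gives \<open>transfer\<close>.\<close>

definition paired_component ::
    "nat \<Rightarrow> nat \<Rightarrow> (real, 'n::{finite,linorder}) vec dform \<Rightarrow> nat \<Rightarrow> (real, 'n) vec \<Rightarrow> real" where
  "paired_component p k \<omega> n =
     (\<lambda>x. \<omega> x (basis_list (subset_enum p k 1 n)) + \<omega> x (basis_list (subset_enum p k (- 1) n)))"

definition transfer ::
    "nat \<Rightarrow> nat \<Rightarrow> nat \<Rightarrow> (real, 'n::{finite,linorder}) vec \<Rightarrow> (real, 'n) vec dform \<Rightarrow> (real, 'n) vec dform" where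
  "transfer p k k' a' \<omega> =
     form_of p (\<lambda>I. reflection_part k' a' (reflection_sign k' I)
       (paired_component p k \<omega> (subset_index p k' I)))"

text \<open>Linearity holds on all forms, not just on eigenforms, because a linear map in the vector
  space locale is defined on the whole type.\<close>

lemma linear_transfer: "Vector_Spaces.linear scale_form scale_form (transfer p k k' a')"
proof
  show "transfer p k k' a' (\<omega> + \<eta>) = transfer p k k' a' \<omega> + transfer p k k' a' \<eta>" for \<omega> \<eta>
  proof -
    have *: "paired_component p k (\<omega> + \<eta>) n =
        (\<lambda>x. paired_component p k \<omega> n x + paired_component p k \<eta> n x)" for n
      unfolding paired_component_def plus_fun_apply by (simp only: add.assoc add.left_commute)
    show ?thesis
      unfolding transfer_def * reflection_part_add
      by (simp add: form_of_def fun_eq_iff distrib_right sum.distrib)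
  qed
  show "transfer p k k' a' (scale_form c \<omega>) = scale_form c (transfer p k k' a' \<omega>)" for c \<omega>
  proof -
    have *: "paired_component p k (scale_form c \<omega>) n = (\<lambda>x. c * paired_component p k \<omega> n x)" for n
      by (simp add: paired_component_def scale_form_def distrib_left)
    show ?thesis
      unfolding transfer_def * reflection_part_cmult
      by (simp add: form_of_def fun_eq_iff scale_form_def sum_distrib_left mult.assoc)
  qed
qed

lemma paired_component_periodic_eigenfunctions:
  assumes "half_integral a" "\<omega> \<in> eigenforms (M_group k a) p \<mu>"
  shows "paired_component p k \<omega> n \<in> periodic_eigenfunctions \<mu>"
  unfolding paired_component_def using eigenforms_component[OF assms]
  by (intro periodic_eigenfunctions_add)

text \<open>Projecting a periodic eigenfunction without any symmetry onto a sign part produces the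
  sign condition required by the target group.\<close>

lemma transfer_in_eigenforms:
  assumes "half_integral a" "half_integral a'" "\<omega> \<in> eigenforms (M_group k a) p \<mu>"
  shows "transfer p k k' a' \<omega> \<in> eigenforms (M_group k' a') p \<mu>"
  unfolding transfer_def
  by (intro form_of_in_eigenforms assms reflection_part_periodic_eigenfunctions
      paired_component_periodic_eigenfunctions[OF assms(1,3)]
      reflection_part_reflect[OF assms(2) paired_component_periodic_eigenfunctions[OF assms(1,3)]]
      reflection_sign_cases)

text \<open>Adding the two sign parts for k' restores the paired functions, and projecting these for
  k separates the original components again. The vanishing at both k and k' makes the pair numbers
  run over the same range.\<close>

lemma transfer_transfer:
  fixes a a' :: "(real, 'n::{finite,linorder}) vec"
  assumes a: "half_integral a"
    and k: "k \<le> CARD('n)" "k' \<le> CARD('n)"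
    and zero: "krawtchouk CARD('n) p (real k) = 0" "krawtchouk CARD('n) p (real k') = 0"
    and \<omega>: "\<omega> \<in> eigenforms (M_group k a) p \<mu>"
  shows "transfer p k' k a (transfer p k k' a' \<omega>) = \<omega>"
proof -
  define N where "N = (CARD('n) choose p) div 2"
  have N: "card (signed_subsets p k s :: 'n set set) = N" "card (signed_subsets p k' s :: 'n set set) = N"
    if "s = 1 \<or> s = -1" for s
    using card_signed_subsets k zero that unfolding N_def by blast+
  have alt: "alternating_form p (\<omega> x)" for x
    using \<omega> by (simp add: eigenforms_def smooth_form_def)
  have pair: "paired_component p k' (transfer p k k' a' \<omega>) n = paired_component p k \<omega> n" if "n < N" for n
  proof -
    have "transfer p k k' a' \<omega> x (basis_list (subset_enum p k' s n)) =
        reflection_part k' a' s (paired_component p k \<omega> n) x" if s: "s = 1 \<or> s = -1" for s x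
      using subset_index_enum[of n p k' s, where 'n='n] N(2)[OF s] \<open>n < N\<close>
      by (simp add: transfer_def form_of_basis_list)
    then show ?thesis
      by (simp add: paired_component_def[of p k' "transfer p k k' a' \<omega>"] reflection_part_sum)
  qed
  have "reflection_part k a (reflection_sign k I)
      (paired_component p k' (transfer p k k' a' \<omega>) (subset_index p k I)) = (\<lambda>x. \<omega> x (basis_list I))"
    if I: "card I = p" for I :: "'n set"
  proof -
    define s where "s = reflection_sign k I"
    define n where "n = subset_index p k I"
    have s: "s = 1 \<or> s = -1" using reflection_sign_cases by (simp add: s_def)
    have "n < N" and I_eq: "subset_enum p k s n = I"
      using subset_enum_index[OF I, of k] N(1)[OF s] by (auto simp: n_def s_def)
    have part: "reflection_part k a s (\<lambda>x. \<omega> x (basis_list (subset_enum p k t n))) =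
        (\<lambda>x. if s = t then \<omega> x (basis_list (subset_enum p k t n)) else 0)" if t: "t = 1 \<or> t = -1" for t
    proof (rule reflection_part_eigen[OF _ s t])
      show "\<omega> (reflect_first k (x + a)) (basis_list (subset_enum p k t n)) =
          t * \<omega> x (basis_list (subset_enum p k t n))" for x
        using eigenforms_component(2)[OF a \<omega>] subset_index_enum[of n p k t, where 'n='n] N(1)[OF t] \<open>n < N\<close>
        by simp
    qed
    have "reflection_part k a s (paired_component p k \<omega> n) = (\<lambda>x. \<omega> x (basis_list (subset_enum p k s n)))"
      unfolding paired_component_def reflection_part_add using part[of 1] part[of "-1"] s by auto
    then show ?thesis using pair[OF \<open>n < N\<close>] I_eq by (simp add: s_def n_def)
  qed
  then have "transfer p k' k a (transfer p k k' a' \<omega>) = form_of p (\<lambda>I x. \<omega> x (basis_list I))"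
    unfolding transfer_def[of p k' k] by (rule form_of_cong)
  then show ?thesis by (simp add: form_of_components[OF alt])
qed

text \<open>A left inverse makes T injective on the span of B, so T carries finite independent sets
  of eigenforms to independent sets of the same size.\<close>

lemma p_spectrum_le:
  assumes T: "Vector_Spaces.linear scale_form scale_form T"
    and T': "Vector_Spaces.linear scale_form scale_form T'"
    and E: "\<And>\<omega>. \<omega> \<in> eigenforms \<Gamma> p \<mu> \<Longrightarrow> T \<omega> \<in> eigenforms \<Gamma>' p \<mu> \<and> T' (T \<omega>) = \<omega>"
  shows "p_spectrum p \<Gamma> \<mu> \<le> p_spectrum p \<Gamma>' \<mu>"
  unfolding p_spectrum_def
proof (rule SUP_mono)
  fix B assume "B \<in> {B. B \<subseteq> eigenforms \<Gamma> p \<mu> \<and> finite B \<and> dform.independent B}"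
  then have B: "B \<subseteq> eigenforms \<Gamma> p \<mu>" "finite B" "dform.independent B" by auto
  interpret vector_space_pair scale_form scale_form by unfold_locales
  \<comment> \<open>The identity is known on the eigenforms in B and extends to their span by
    linearity, without showing that eigenforms make up a subspace.\<close>
  have "(T' \<circ> T) \<omega> = \<omega>" if "\<omega> \<in> dform.span B" for \<omega>
    using linear_eq_on[OF Vector_Spaces.linear_compose[OF T T'] dform.linear_ident that] B E by auto
  then have inj: "inj_on T (dform.span B)" by (metis comp_apply inj_onI)
  then have "dform.independent (T ` B)"
    by (intro linear_independent_injective_image T B)
  moreover have "card (T ` B) = card B"
    by (intro card_image inj_on_subset[OF inj dform.span_superset])
  ultimately show "\<exists>B'\<in>{B. B \<subseteq> eigenforms \<Gamma>' p \<mu> \<and> finite B \<and> dform.independent B}. enat (card B) \<le> enat (card B')"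
    using B E by (intro bexI[of _ "T ` B"]) auto
qed

lemma p_isospectral_M_group:
  fixes a a' :: "(real, 'n::{finite,linorder}) vec"
  assumes "half_integral a" "half_integral a'" "k \<le> CARD('n)" "k' \<le> CARD('n)"
    and "krawtchouk CARD('n) p (real k) = 0" "krawtchouk CARD('n) p (real k') = 0"
  shows "p_isospectral p (M_group k a) (M_group k' a')"
  unfolding p_isospectral_def
proof (rule ext, rule antisym)
  fix \<mu>
  show "p_spectrum p (M_group k a) \<mu> \<le> p_spectrum p (M_group k' a') \<mu>"
    by (rule p_spectrum_le[where T = "transfer p k k' a'" and T' = "transfer p k' k a"])
      (auto intro: linear_transfer transfer_in_eigenforms transfer_transfer assms)
  show "p_spectrum p (M_group k' a') \<mu> \<le> p_spectrum p (M_group k a) \<mu>"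
    by (rule p_spectrum_le[where T = "transfer p k' k a" and T' = "transfer p k k' a'"])
      (auto intro: linear_transfer transfer_in_eigenforms transfer_transfer assms)
qed

section \<open>Singular strata\<close>

text \<open>In an unreflected coordinate with a_i = 1/2, a fixed point of an element of the
  nontrivial coset would require the integer b_i to be -1/2.\<close>

lemma is_manifold_M_group:
  fixes a :: "(real, 'n::{finite,linorder}) vec"
  assumes a: "half_vector k a"
  shows "is_manifold (M_group k a)"
  unfolding is_manifold_def
proof
  fix x
  have h: "half_integral a" using a by (simp add: half_vector_def half_integral_def)
  obtain i where i: "k < coord_number i" "a $ i = 1 / 2" using a by (auto simp: half_vector_def)
  have "f = id" if f: "f \<in> M_group k a" "f x = x" for f
  proof -
    obtain b where b: "\<forall>i. b $ i \<in> \<int>"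
      and cases: "f = (\<lambda>x. x + b) \<or> f = (\<lambda>x. reflect_first k (x + a) + b)"
      using f(1) unfolding mem_M_group_iff[OF h] by blast
    show ?thesis
    proof (cases "f = (\<lambda>x. x + b)")
      case True
      then show ?thesis using f(2) by auto
    next
      case False
      then have "reflect_first k (x + a) + b = x" using cases f(2) by simp
      then have "(reflect_first k (x + a) + b) $ i = x $ i" by simp
      then have "b $ i = - (1 / 2)" using i by (simp add: reflect_first_nth)
      moreover have "b $ i \<in> \<int>" using b by blast
      ultimately have "1 / 2 \<in> (\<int> :: real set)" by (metis Ints_minus minus_minus)
      then show ?thesis using Ints_nonzero_abs_less1[of "1 / 2 :: real"] by simp
    qed
  qed
  moreover have "id \<in> M_group k a"
    unfolding mem_M_group_iff[OF h] by (intro exI[of _ 0]) (simp add: id_def)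
  ultimately show "stabilizer_of (M_group k a) x = {id}" by (auto simp: stabilizer_of_def)
qed

section \<open>Orbits and stabilizers of the orbifold group\<close>

lemma half_integral_0: "half_integral 0"
  by (simp add: half_integral_def)

lemma mem_O_group_iff:
  "f \<in> O_group k \<longleftrightarrow> (\<exists>b. (\<forall>i. b $ i \<in> \<int>) \<and>
     (f = (\<lambda>x. x + b) \<or> f = (\<lambda>x. reflect_first k x + b)))"
  unfolding O_group_eq_M_group mem_M_group_iff[OF half_integral_0] by simp

lemma mem_orbit_of_O_group_iff:
  "y \<in> orbit_of (O_group k) x \<longleftrightarrow>
     (\<forall>i. (y - x) $ i \<in> \<int>) \<or> (\<forall>i. (y - reflect_first k x) $ i \<in> \<int>)" (is "_ \<longleftrightarrow> ?T \<or> ?R")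
proof
  assume "y \<in> orbit_of (O_group k) x"
  then show "?T \<or> ?R" unfolding orbit_of_def mem_O_group_iff[abs_def] by (auto simp: mem_O_group_iff)
next
  have eq: "y = x + (y - x)" "y = reflect_first k x + (y - reflect_first k x)" by simp_all
  assume "?T \<or> ?R"
  then show "y \<in> orbit_of (O_group k) x"
  proof
    assume ?T
    then have "(\<lambda>z. z + (y - x)) \<in> O_group k" unfolding mem_O_group_iff by blast
    then show ?thesis unfolding orbit_of_def by (rule image_eqI[rotated]) simp
  next
    assume ?R
    then have "(\<lambda>z. reflect_first k z + (y - reflect_first k x)) \<in> O_group k"
      unfolding mem_O_group_iff by blast
    then show ?thesis unfolding orbit_of_def by (rule image_eqI[rotated]) simp
  qed
qed

lemma mem_orbit_of_self: "x \<in> orbit_of (O_group k) x"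
  by (simp add: mem_orbit_of_O_group_iff)

lemma mem_orbit_of_O_group_sym:
  assumes "y \<in> orbit_of (O_group k) x"
  shows "x \<in> orbit_of (O_group k) y"
proof -
  have 1: "\<forall>i. (x - y) $ i \<in> \<int>" if "\<forall>i. (y - x) $ i \<in> \<int>"
    using that by (metis Ints_minus minus_diff_eq vector_uminus_component)
  have 2: "\<forall>i. (x - reflect_first k y) $ i \<in> \<int>" if *: "\<forall>i. (y - reflect_first k x) $ i \<in> \<int>"
  proof
    fix i
    have "x - reflect_first k y = - reflect_first k (y - reflect_first k x)"
      by (simp add: linear_diff[OF linear_reflect_first])
    then show "(x - reflect_first k y) $ i \<in> \<int>"
      using reflect_first_in_Ints[OF *, of k i] by (simp add: Ints_minus)
  qed
  show ?thesis using assms 1 2 unfolding mem_orbit_of_O_group_iff by blast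
qed

lemma mem_orbit_of_O_group_trans:
  assumes "y \<in> orbit_of (O_group k) x" "z \<in> orbit_of (O_group k) y"
  shows "z \<in> orbit_of (O_group k) x"
proof -
  have add: "\<forall>i. (u + v) $ i \<in> \<int>" if "\<forall>i. u $ i \<in> \<int>" "\<forall>i. v $ i \<in> \<int>" for u v :: "(real, 'a) vec"
    using that by (metis Ints_add vector_add_component)
  have refl: "\<forall>i. (reflect_first k (u - v)) $ i \<in> \<int>" if "\<forall>i. (u - v) $ i \<in> \<int>" for u v :: "(real, 'a) vec"
    using reflect_first_in_Ints[OF that] by blast
  have diff: "reflect_first k (u - v) = reflect_first k u - reflect_first k v" for u v :: "(real, 'a) vec"
    by (rule linear_diff[OF linear_reflect_first])
  show ?thesis
    using assms unfolding mem_orbit_of_O_group_iff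
  proof (elim disjE)
    assume "\<forall>i. (y - x) $ i \<in> \<int>" "\<forall>i. (z - y) $ i \<in> \<int>"
    from add[OF this] show "(\<forall>i. (z - x) $ i \<in> \<int>) \<or> (\<forall>i. (z - reflect_first k x) $ i \<in> \<int>)" by simp
  next
    assume "\<forall>i. (y - x) $ i \<in> \<int>" "\<forall>i. (z - reflect_first k y) $ i \<in> \<int>"
    from add[OF refl[OF this(1)] this(2)]
    show "(\<forall>i. (z - x) $ i \<in> \<int>) \<or> (\<forall>i. (z - reflect_first k x) $ i \<in> \<int>)" by (simp add: diff)
  next
    assume "\<forall>i. (y - reflect_first k x) $ i \<in> \<int>" "\<forall>i. (z - y) $ i \<in> \<int>"
    from add[OF this] show "(\<forall>i. (z - x) $ i \<in> \<int>) \<or> (\<forall>i. (z - reflect_first k x) $ i \<in> \<int>)" by simp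
  next
    assume "\<forall>i. (y - reflect_first k x) $ i \<in> \<int>" "\<forall>i. (z - reflect_first k y) $ i \<in> \<int>"
    from add[OF refl[OF this(1)] this(2)]
    show "(\<forall>i. (z - x) $ i \<in> \<int>) \<or> (\<forall>i. (z - reflect_first k x) $ i \<in> \<int>)" by (simp add: diff)
  qed
qed

lemma orbit_of_O_group_eq_iff:
  "orbit_of (O_group k) x = orbit_of (O_group k) y \<longleftrightarrow> y \<in> orbit_of (O_group k) x"
  using mem_orbit_of_self mem_orbit_of_O_group_sym mem_orbit_of_O_group_trans by blast

definition singular_lift :: "nat \<Rightarrow> (real, 'n::{finite,linorder}) vec \<Rightarrow> bool" where
  "singular_lift k x \<longleftrightarrow> (\<forall>i. coord_number i \<le> k \<longrightarrow> 2 * x $ i \<in> \<int>)"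

lemma singular_lift_iff: "singular_lift k x \<longleftrightarrow> (\<forall>i. (x - reflect_first k x) $ i \<in> \<int>)"
  by (auto simp: singular_lift_def reflect_first_nth)

text \<open>A nontrivial translation fixes nothing, and an element gamma_k + b fixes x only for b =
  x - gamma_k x, which must then be integral.\<close>

lemma stabilizer_of_O_group:
  "stabilizer_of (O_group k) x =
     (if singular_lift k x then {id, \<lambda>z. reflect_first k z + (x - reflect_first k x)} else {id})"
proof -
  have "id \<in> O_group k" unfolding mem_O_group_iff by (intro exI[of _ 0]) (simp add: id_def)
  moreover have "(\<lambda>z. reflect_first k z + (x - reflect_first k x)) \<in> O_group k" if "singular_lift k x"
    using that unfolding singular_lift_iff mem_O_group_iff by blast
  moreover have "f = id \<or> (singular_lift k x \<and> f = (\<lambda>z. reflect_first k z + (x - reflect_first k x)))"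
    if f: "f \<in> O_group k" "f x = x" for f
  proof -
    obtain b where b: "\<forall>i. b $ i \<in> \<int>"
      and cases: "f = (\<lambda>x. x + b) \<or> f = (\<lambda>x. reflect_first k x + b)"
      using f(1) unfolding mem_O_group_iff by blast
    from cases show ?thesis
    proof
      assume "f = (\<lambda>x. x + b)"
      then show ?thesis using f(2) by auto
    next
      assume f': "f = (\<lambda>x. reflect_first k x + b)"
      then have "b = x - reflect_first k x" using f(2) by (metis add_diff_cancel_left')
      then show ?thesis using f' b unfolding singular_lift_iff by blast
    qed
  qed
  ultimately show ?thesis by (auto simp: stabilizer_of_def)
qed

lemma ex_coord_number:
  assumes "1 \<le> m" "m \<le> CARD('n)"
  obtains i :: "'n::{finite,linorder}" where "coord_number i = m"
proof -
  have "m \<in> range (coord_number :: 'n \<Rightarrow> nat)"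
    using coord_number_bij[where 'n='n] assms by (auto simp: bij_betw_def)
  then show thesis using that by auto
qed

lemma stabilizer_of_O_group_nontrivial_iff:
  fixes x :: "(real, 'n::{finite,linorder}) vec"
  assumes "1 \<le> k"
  shows "stabilizer_of (O_group k) x \<noteq> {id} \<longleftrightarrow> singular_lift k x"
proof -
  have "(\<lambda>z. reflect_first k z + c) \<noteq> id" for c :: "(real, 'n) vec"
  proof
    \<comment> \<open>Coordinate 1 is reflected because \<open>1 \<le> k\<close>. Comparing the
      images of 0 and of the first basis vector there would give c_i = 0 and c_i - 1 = 1.\<close>
    obtain i :: 'n where i: "coord_number i = 1"
      using ex_coord_number[of 1] by (metis One_nat_def Suc_leI le_refl zero_less_card_finite)
    assume "(\<lambda>z. reflect_first k z + c) = id"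
    then have "reflect_first k 0 + c = 0" "reflect_first k (axis i 1) + c = axis i 1"
      by (metis id_apply)+
    then have "(reflect_first k 0 + c) $ i = 0" "(reflect_first k (axis i 1) + c) $ i = 1"
      by (simp_all add: axis_def)
    then show False using i assms by (simp add: reflect_first_nth axis_def)
  qed
  then show ?thesis by (auto simp: stabilizer_of_O_group)
qed

text \<open>The right-hand side is independent of x, so there is one singular isotropy type and the
  strata are the components of the whole singular set.\<close>

lemma isotropy_type_O_group:
  fixes x :: "(real, 'n::{finite,linorder}) vec"
  assumes "singular_lift k x"
  shows "isotropy_type (O_group k) x =
    {(\<lambda>A :: (real, 'n) vec \<Rightarrow> (real, 'n) vec. B \<circ> A \<circ> inv_into UNIV B) ` {id, reflect_first k} |B.
      orthogonal_transformation B}"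
proof -
  have "reflect_first k 0 = (0 :: (real, 'n) vec)" by (rule linear_0[OF linear_reflect_first])
  then have "linear_part ` stabilizer_of (O_group k) x = {id, reflect_first k}"
    using assms by (simp add: stabilizer_of_O_group linear_part_def id_def)
  then show ?thesis unfolding isotropy_type_def by (simp only:)
qed

section \<open>Topology of the quotient\<close>

lemma topspace_orbifold_topology: "topspace (orbifold_topology \<Gamma>) = range (orbit_of \<Gamma>)"
proof
  show "topspace (orbifold_topology \<Gamma>) \<subseteq> range (orbit_of \<Gamma>)"
    using openin_topspace[of "orbifold_topology \<Gamma>"] unfolding openin_orbifold_topology by blast
  have "{x. orbit_of \<Gamma> x \<in> range (orbit_of \<Gamma>)} = UNIV" by blast
  then have "openin (orbifold_topology \<Gamma>) (range (orbit_of \<Gamma>))"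
    unfolding openin_orbifold_topology by simp
  then show "range (orbit_of \<Gamma>) \<subseteq> topspace (orbifold_topology \<Gamma>)" by (rule openin_subset)
qed

lemma closedin_orbifold_topology:
  assumes "C \<subseteq> range (orbit_of \<Gamma>)" "closed {x. orbit_of \<Gamma> x \<in> C}"
  shows "closedin (orbifold_topology \<Gamma>) C"
proof -
  have "{x. orbit_of \<Gamma> x \<in> range (orbit_of \<Gamma>) - C} = - {x. orbit_of \<Gamma> x \<in> C}" by auto
  then show ?thesis using assms
    by (simp add: closedin_def topspace_orbifold_topology openin_orbifold_topology open_Compl)
qed

lemma continuous_map_orbit_of: "continuous_map euclidean (orbifold_topology \<Gamma>) (orbit_of \<Gamma>)"
  by (auto simp: continuous_map_def topspace_orbifold_topology openin_orbifold_topology)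

text \<open>The saturation of U is the union of its preimages under the group elements, which are
  continuous.\<close>

lemma open_map_orbit_of_O_group:
  assumes "open U"
  shows "openin (orbifold_topology (O_group k)) (orbit_of (O_group k) ` U)"
  unfolding openin_orbifold_topology
proof
  have "{x. orbit_of (O_group k) x \<in> orbit_of (O_group k) ` U} = (\<Union>f\<in>O_group k. f -` U)"
    by (auto simp: image_iff orbit_of_O_group_eq_iff) (auto simp: orbit_of_def)
  moreover have "open (f -` U)" if f: "f \<in> O_group k" for f
  proof -
    have refl: "continuous_on UNIV (reflect_first k)"
      using linear_reflect_first linear_conv_bounded_linear by (intro linear_continuous_on) blast
    obtain b where "f = (\<lambda>x. x + b) \<or> f = (\<lambda>x. reflect_first k x + b)"
      using f unfolding mem_O_group_iff by blast
    then have "continuous_on UNIV f"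
    proof
      assume "f = (\<lambda>x. x + b)"
      then show ?thesis by (simp add: continuous_on_add)
    next
      assume "f = (\<lambda>x. reflect_first k x + b)"
      then show ?thesis using continuous_on_add[OF refl continuous_on_const] by simp
    qed
    then show ?thesis using assms by (simp add: open_vimage)
  qed
  ultimately show "open {x. orbit_of (O_group k) x \<in> orbit_of (O_group k) ` U}" by auto
qed blast

text \<open>By finiteness the other pieces have a closed union, so each piece is also open. A
  component meeting a piece lies inside it because the piece is clopen, and contains it because the
  piece is connected.\<close>

lemma connected_components_of_finite_closed_partition:
  assumes fin: "finite \<P>" and closed: "\<And>P. P \<in> \<P> \<Longrightarrow> closedin X P"
    and conn: "\<And>P. P \<in> \<P> \<Longrightarrow> connectedin X P" and ne: "{} \<notin> \<P>"
    and disj: "pairwise disjnt \<P>" and Un: "\<Union>\<P> = topspace X"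
  shows "connected_components_of X = \<P>"
proof -
  have clopen: "openin X P" if P: "P \<in> \<P>" for P
  proof -
    have "closedin X (\<Union>(\<P> - {P}))" using fin closed by (intro closedin_Union) auto
    moreover have "P \<inter> Q = {}" if "Q \<in> \<P> - {P}" for Q
      using pairwiseD[OF disj P] that by (auto simp: disjnt_def)
    then have "topspace X - \<Union>(\<P> - {P}) = P" using P Un by blast
    ultimately show ?thesis by (metis closedin_def)
  qed
  have eq: "C = P" if C: "C \<in> connected_components_of X" and P: "P \<in> \<P>" and "\<not> disjnt C P" for C P
  proof
    show "C \<subseteq> P"
      using connectedin_clopen_cases[OF connectedin_connected_components_of[OF C] closed[OF P] clopen[OF P]]
        that(3) by blast
    show "P \<subseteq> C" using connected_components_of_maximal[OF C conn[OF P] that(3)] .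
  qed
  show ?thesis
  proof
    show "connected_components_of X \<subseteq> \<P>"
    proof
      fix C assume C: "C \<in> connected_components_of X"
      then obtain x where "x \<in> C" "x \<in> topspace X"
        using nonempty_connected_components_of connected_components_of_subset by blast
      then obtain P where "P \<in> \<P>" "x \<in> P" using Un by blast
      then show "C \<in> \<P>" using eq[OF C] \<open>x \<in> C\<close> by (metis disjnt_iff)
    qed
    show "\<P> \<subseteq> connected_components_of X"
    proof
      fix P assume P: "P \<in> \<P>"
      then have "P \<noteq> {}" using ne by metis
      then obtain x where "x \<in> P" by blast
      then have x: "x \<in> P" "x \<in> topspace X" using P Un by blast+
      then obtain C where "C \<in> connected_components_of X" "x \<in> C"
        using Union_connected_components_of[of X] by blast
      then show "P \<in> connected_components_of X" using eq[OF _ P] x by (metis disjnt_iff)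
    qed
  qed
qed

section \<open>The pieces of the singular set\<close>

definition half_indicator :: "'n set \<Rightarrow> 'n \<Rightarrow> real" where
  "half_indicator T i = (if i \<in> T then 1 / 2 else 0)"

text \<open>A single affine subspace of dimension d - k for k at most d; the full preimage of the
  stratum is the union of its lattice translates. T records which reflected coordinates equal
  1/2.\<close>

definition stratum_lift :: "nat \<Rightarrow> 'n set \<Rightarrow> (real, 'n::{finite,linorder}) vec set" where
  "stratum_lift k T = {x. \<forall>i. coord_number i \<le> k \<longrightarrow> x $ i = half_indicator T i}"

definition stratum :: "nat \<Rightarrow> 'n set \<Rightarrow> (real, 'n::{finite,linorder}) vec set set" where
  "stratum k T = orbit_of (O_group k) ` stratum_lift k T"

text \<open>The reflection preserves the classes of 0 and of 1/2 modulo 1, since -1/2 and 1/2 differ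
  by an integer.\<close>

lemma orbit_of_in_stratum_iff:
  fixes x :: "(real, 'n::{finite,linorder}) vec"
  shows
  "orbit_of (O_group k) x \<in> stratum k T \<longleftrightarrow>
     (\<forall>i. coord_number i \<le> k \<longrightarrow> x $ i - half_indicator T i \<in> \<int>)"
proof
  assume "orbit_of (O_group k) x \<in> stratum k T"
  then obtain y where "y \<in> stratum_lift k T" and eq: "orbit_of (O_group k) x = orbit_of (O_group k) y"
    unfolding stratum_def by blast
  then have y: "\<And>i. coord_number i \<le> k \<Longrightarrow> y $ i = half_indicator T i"
    by (simp add: stratum_lift_def)
  have "x \<in> orbit_of (O_group k) y" using mem_orbit_of_self eq by blast
  then have "(\<forall>i. x $ i - y $ i \<in> \<int>) \<or> (\<forall>i. x $ i - reflect_first k y $ i \<in> \<int>)"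
    by (simp add: mem_orbit_of_O_group_iff)
  then show "\<forall>i. coord_number i \<le> k \<longrightarrow> x $ i - half_indicator T i \<in> \<int>"
  proof
    assume *: "\<forall>i. x $ i - reflect_first k y $ i \<in> \<int>"
    show ?thesis
    proof (intro allI impI)
      fix i :: 'n assume i: "coord_number i \<le> k"
      have "x $ i + half_indicator T i \<in> \<int>" using spec[OF * , of i] i y by (simp add: reflect_first_nth)
      moreover have "2 * half_indicator T i \<in> \<int>" by (simp add: half_indicator_def)
      ultimately have "(x $ i + half_indicator T i) - 2 * half_indicator T i \<in> \<int>" by (rule Ints_diff)
      then show "x $ i - half_indicator T i \<in> \<int>" by simp
    qed
  qed (use y in metis)
next
  assume *: "\<forall>i. coord_number i \<le> k \<longrightarrow> x $ i - half_indicator T i \<in> \<int>"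
  \<comment> \<open>Only the reflected coordinates are moved to their normal form, each by an
    integer, so y is a lattice translate of x.\<close>
  define y where "y = (\<chi> i. if coord_number i \<le> k then half_indicator T i else x $ i)"
  have "y \<in> stratum_lift k T" by (simp add: y_def stratum_lift_def)
  moreover have "x \<in> orbit_of (O_group k) y"
    using * by (simp add: mem_orbit_of_O_group_iff y_def)
  then have "orbit_of (O_group k) x = orbit_of (O_group k) y" using orbit_of_O_group_eq_iff by blast
  ultimately show "orbit_of (O_group k) x \<in> stratum k T" unfolding stratum_def by blast
qed

lemma singular_lift_in_stratum:
  fixes x :: "(real, 'n::{finite,linorder}) vec"
  assumes "singular_lift k x"
  shows "orbit_of (O_group k) x \<in> stratum k {i. coord_number i \<le> k \<and> x $ i \<notin> \<int>}"
  unfolding orbit_of_in_stratum_iff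
proof (intro allI impI)
  fix i :: 'n
  assume i: "coord_number i \<le> k"
  then obtain m where m: "2 * x $ i = of_int m" using assms by (auto simp: singular_lift_def elim: Ints_cases)
  show "x $ i - half_indicator {i. coord_number i \<le> k \<and> x $ i \<notin> \<int>} i \<in> \<int>"
  proof (cases "x $ i \<in> \<int>")
    case False
    \<comment> \<open>Half of an even m would be an integer; half of an odd m is congruent to
      1/2.\<close>
    have "odd m"
    proof
      assume "even m"
      then obtain l where "m = 2 * l" by blast
      then have "x $ i = of_int l" using m by simp
      then show False using False by simp
    qed
    then obtain l where "m = 2 * l + 1" by (rule oddE)
    then have "x $ i - 1 / 2 = of_int l" using m by simp
    then show ?thesis using i False by (simp add: half_indicator_def)
  qed (simp add: half_indicator_def)
qed

text \<open>Two values out of 0 and 1/2 that are congruent modulo 1 coincide.\<close>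

lemma stratum_disjoint:
  assumes "orbit_of (O_group k) x \<in> stratum k T" "orbit_of (O_group k) x \<in> stratum k T'"
    "coord_number i \<le> k"
  shows "i \<in> T \<longleftrightarrow> i \<in> T'"
proof -
  have "x $ i - half_indicator T i \<in> \<int>" "x $ i - half_indicator T' i \<in> \<int>"
    using assms unfolding orbit_of_in_stratum_iff by blast+
  then have "(x $ i - half_indicator T i) - (x $ i - half_indicator T' i) \<in> \<int>" by (rule Ints_diff)
  then have "half_indicator T' i - half_indicator T i \<in> \<int>" by simp
  then have "half_indicator T' i - half_indicator T i = 0"
    by (rule Ints_nonzero_abs_less1) (simp add: half_indicator_def)
  then show ?thesis by (auto simp: half_indicator_def split: if_splits)
qed

lemma half_indicator_in_stratum:
  "orbit_of (O_group k) (\<chi> i. half_indicator T i) \<in> stratum k T"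
  by (simp add: orbit_of_in_stratum_iff)

lemma singular_set_O_group:
  fixes k :: nat
  assumes k: "1 \<le> k"
  shows "singular_set (O_group k) = orbit_of (O_group k) ` {x :: (real, 'n::{finite,linorder}) vec. singular_lift k x}"
  unfolding singular_set_def using stabilizer_of_O_group_nontrivial_iff[OF k] by blast

lemma Union_strata:
  assumes k: "1 \<le> k"
  shows "\<Union>(stratum k ` Pow {i. coord_number i \<le> k}) =
    (singular_set (O_group k) :: (real, 'n::{finite,linorder}) vec set set)"
  unfolding singular_set_O_group[OF k]
proof
  show "\<Union>(stratum k ` Pow {i. coord_number i \<le> k}) \<subseteq>
      orbit_of (O_group k) ` {x :: (real, 'n) vec. singular_lift k x}"
  proof -
    have "2 * half_indicator T i \<in> \<int>" for T and i :: 'n by (simp add: half_indicator_def)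
    then have "stratum_lift k T \<subseteq> {x :: (real, 'n) vec. singular_lift k x}" for T
      by (auto simp: stratum_lift_def singular_lift_def)
    then show ?thesis unfolding stratum_def by blast
  qed
  show "orbit_of (O_group k) ` {x :: (real, 'n) vec. singular_lift k x} \<subseteq>
      \<Union>(stratum k ` Pow {i. coord_number i \<le> k})"
    using singular_lift_in_stratum by fastforce
qed

lemma singular_strata_O_group:
  assumes k: "1 \<le> k"
  shows "singular_strata (O_group k :: ((real, 'n::{finite,linorder}) vec \<Rightarrow> (real, 'n) vec) set) =
    stratum k ` Pow {i. coord_number i \<le> k}"
proof -
  let ?\<Gamma> = "O_group k :: ((real, 'n) vec \<Rightarrow> (real, 'n) vec) set"
  let ?X = "orbifold_topology ?\<Gamma>"
  \<comment> \<open>The isotropy type of every singular point; any other type has no singular points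
    and contributes no component.\<close>
  define \<tau> :: "((real, 'n) vec \<Rightarrow> (real, 'n) vec) set set" where
    "\<tau> = {(\<lambda>A :: (real, 'n) vec \<Rightarrow> (real, 'n) vec. B \<circ> A \<circ> inv_into UNIV B) ` {id, reflect_first k} |B. orthogonal_transformation B}"
  have type: "singular_points_of_type ?\<Gamma> \<sigma> = (if \<sigma> = \<tau> then singular_set ?\<Gamma> else {})" for \<sigma>
    using isotropy_type_O_group[where k = k and 'n = 'n] stabilizer_of_O_group_nontrivial_iff[OF k, where 'n='n]
    unfolding singular_points_of_type_def singular_set_def \<tau>_def by auto
  have "connected_components_of (subtopology ?X (singular_points_of_type ?\<Gamma> \<sigma>)) =
      (if \<sigma> = \<tau> then connected_components_of (subtopology ?X (singular_set ?\<Gamma>)) else {})" for \<sigma>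
    by (simp add: type connected_components_of_empty_space)
  then have "singular_strata ?\<Gamma> = connected_components_of (subtopology ?X (singular_set ?\<Gamma>))"
    unfolding singular_strata_def by auto
  also have "\<dots> = stratum k ` Pow {i. coord_number i \<le> k}"
  proof (rule connected_components_of_finite_closed_partition)
    show "finite (stratum k ` Pow {i :: 'n. coord_number i \<le> k})" by simp
    show "{} \<notin> stratum k ` Pow {i :: 'n. coord_number i \<le> k}"
      using half_indicator_in_stratum by force
    show "pairwise disjnt (stratum k ` Pow {i :: 'n. coord_number i \<le> k})"
      unfolding pairwise_def disjnt_def
    proof (clarsimp, rule ccontr)
      fix T T' :: "'n set" assume *: "T \<subseteq> {i. coord_number i \<le> k}" "T' \<subseteq> {i. coord_number i \<le> k}"
        "stratum k T \<noteq> stratum k T'" "stratum k T \<inter> stratum k T' \<noteq> {}"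
      then obtain x where "orbit_of (O_group k) x \<in> stratum k T" "orbit_of (O_group k) x \<in> stratum k T'"
        unfolding stratum_def by fastforce
      then have "T = T'" using * stratum_disjoint by blast
      then show False using * by simp
    qed
    have sub: "singular_set ?\<Gamma> \<subseteq> topspace ?X"
      by (auto simp: topspace_orbifold_topology singular_set_def)
    then show "\<Union>(stratum k ` Pow {i :: 'n. coord_number i \<le> k}) = topspace (subtopology ?X (singular_set ?\<Gamma>))"
      unfolding Union_strata[OF k] by auto
    fix P assume "P \<in> stratum k ` Pow {i :: 'n. coord_number i \<le> k}"
    then obtain T where P: "P = stratum k T" and T: "T \<subseteq> {i :: 'n. coord_number i \<le> k}" by auto
    then have P_sub: "P \<subseteq> singular_set ?\<Gamma>" using Union_strata[OF k, where 'n='n] by auto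
    have closed_Ints: "closed (\<int> :: real set)" unfolding Ints_def by (rule closed_of_int_image)
    have "closed {x :: (real, 'n) vec. orbit_of ?\<Gamma> x \<in> stratum k T}"
    proof -
      have "closed ((\<lambda>x :: (real, 'n) vec. x $ i - half_indicator T i) -` \<int>)" for i
        by (intro continuous_closed_vimage closed_Ints) (auto intro!: continuous_intros)
      then have "closed (\<Inter>i\<in>{i. coord_number i \<le> k}. (\<lambda>x :: (real, 'n) vec. x $ i - half_indicator T i) -` \<int>)"
        by (intro closed_INT) auto
      also have "(\<Inter>i\<in>{i. coord_number i \<le> k}. (\<lambda>x :: (real, 'n) vec. x $ i - half_indicator T i) -` \<int>) =
          {x. orbit_of ?\<Gamma> x \<in> stratum k T}"
        by (auto simp: orbit_of_in_stratum_iff)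
      finally show ?thesis .
    qed
    then have "closedin ?X P"
      unfolding P by (intro closedin_orbifold_topology) (auto simp: stratum_def)
    then show "closedin (subtopology ?X (singular_set ?\<Gamma>)) P"
      using P_sub by (simp add: closedin_subset_topspace closedin_closed_subtopology closedin_subtopology) blast
    \<comment> \<open>Connectedness comes from upstairs: the piece is the continuous image of one
      affine subspace.\<close>
    have "convex (stratum_lift k T)"
      unfolding stratum_lift_def convex_def by (auto simp: algebra_simps simp flip: distrib_right)
    then have "connectedin euclidean (stratum_lift k T)" by (simp add: convex_connected)
    then have "connectedin ?X P"
      unfolding P stratum_def by (rule connectedin_continuous_map_image[OF continuous_map_orbit_of])
    then show "connectedin (subtopology ?X (singular_set ?\<Gamma>)) P"
      using P_sub by (simp add: connectedin_subtopology)
  qed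
  finally show ?thesis .
qed

lemma card_singular_strata_O_group:
  assumes k: "1 \<le> k" "k \<le> CARD('n::{finite,linorder})"
  shows "card (singular_strata (O_group k :: ((real, 'n) vec \<Rightarrow> (real, 'n) vec) set)) = 2 ^ k"
proof -
  have "inj_on (stratum k) (Pow {i :: 'n. coord_number i \<le> k})"
  proof (rule inj_onI)
    fix T T' :: "'n set"
    assume "T \<in> Pow {i. coord_number i \<le> k}" "T' \<in> Pow {i. coord_number i \<le> k}" "stratum k T = stratum k T'"
    then show "T = T'" using stratum_disjoint half_indicator_in_stratum by blast
  qed
  then show ?thesis
    using card_coord_number_le[OF k(2)]
    by (simp add: singular_strata_O_group[OF k(1)] card_image card_Pow)
qed

lemma Euclidean_space_eq_top_of_set: "Euclidean_space m = top_of_set {g. \<forall>i\<ge>m. g i = 0}"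
  by (simp add: Euclidean_space_def euclidean_product_topology)

text \<open>Forgetting the k prescribed coordinates identifies the affine subspace with R^(d-k); the
  inverse reinserts them.\<close>

lemma stratum_lift_chart:
  fixes U :: "(real, 'n::{finite,linorder}) vec set"
  assumes "open U"
  obtains W where "openin (Euclidean_space (CARD('n) - k)) W"
    "top_of_set (stratum_lift k T \<inter> U) homeomorphic_space
       subtopology (Euclidean_space (CARD('n) - k)) W"
proof -
  define m where "m = CARD('n) - k"
  define E where "E = {g :: nat \<Rightarrow> real. \<forall>i\<ge>m. g i = 0}"
  \<comment> \<open>Coordinates are numbered from 1 and the model space from 0, so coordinate k + 1
    goes to index 0.\<close>
  define \<psi> :: "(nat \<Rightarrow> real) \<Rightarrow> (real, 'n) vec" where
    "\<psi> g = (\<chi> i. if coord_number i \<le> k then half_indicator T i else g (coord_number i - Suc k))" for g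
  define coord :: "nat \<Rightarrow> 'n" where "coord j = inv_into UNIV coord_number (Suc (k + j))" for j
  define \<phi> :: "(real, 'n) vec \<Rightarrow> nat \<Rightarrow> real" where
    "\<phi> x j = (if j < m then x $ coord j else 0)" for x j
  define W where "W = E \<inter> \<psi> -` U"
  have coord_number_coord: "coord_number (coord j :: 'n) = Suc (k + j)" if "j < m" for j
    unfolding coord_def using coord_number_bij[where 'n='n] that
    by (intro f_inv_into_f) (auto simp: bij_betw_def m_def)
  have coord_coord_number: "coord (coord_number i - Suc k) = i" and in_range: "coord_number i - Suc k < m"
    if "\<not> coord_number i \<le> k" for i :: 'n
  proof -
    have "inj (coord_number :: 'n \<Rightarrow> nat)" "coord_number i \<le> CARD('n)"
      using coord_number_bij[where 'n='n] by (auto simp: bij_betw_def)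
    then show "coord (coord_number i - Suc k) = i" "coord_number i - Suc k < m"
      using that by (auto simp: coord_def m_def)
  qed
  have \<psi>_cont: "continuous_on UNIV \<psi>"
  proof -
    have "continuous_on UNIV (\<lambda>g. if coord_number i \<le> k then half_indicator T i
        else g (coord_number i - Suc k))" for i :: 'n
      by (cases "coord_number i \<le> k") simp_all
    then show ?thesis unfolding \<psi>_def by (rule continuous_on_vec_lambda)
  qed
  have \<phi>_cont: "continuous_on UNIV \<phi>"
  proof (rule continuous_on_coordinatewise_then_product)
    show "continuous_on UNIV (\<lambda>x. \<phi> x j)" for j
      by (cases "j < m") (simp_all add: \<phi>_def continuous_on_component)
  qed
  have \<psi>\<phi>: "\<psi> (\<phi> x) = x" if "x \<in> stratum_lift k T" for x
    using that by (auto simp: vec_eq_iff \<psi>_def \<phi>_def stratum_lift_def coord_coord_number in_range)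
  have \<phi>\<psi>: "\<phi> (\<psi> g) = g" if "g \<in> E" for g
    using that by (auto simp: fun_eq_iff \<psi>_def \<phi>_def E_def coord_number_coord)
  have \<psi>_lift: "\<psi> g \<in> stratum_lift k T" for g by (simp add: \<psi>_def stratum_lift_def)
  have \<phi>_E: "\<phi> x \<in> E" for x by (simp add: \<phi>_def E_def)
  have "open (\<psi> -` U)" using \<psi>_cont assms by (simp add: open_vimage)
  then have "openin (Euclidean_space m) W"
    unfolding Euclidean_space_eq_top_of_set W_def E_def by (rule openin_open_Int)
  moreover have "homeomorphic_maps (top_of_set (stratum_lift k T \<inter> U)) (top_of_set W) \<phi> \<psi>"
    unfolding homeomorphic_maps_def
    using continuous_on_subset[OF \<psi>_cont] continuous_on_subset[OF \<phi>_cont]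
    by (auto simp: W_def \<psi>\<phi> \<phi>\<psi> \<psi>_lift \<phi>_E)
  then have "top_of_set (stratum_lift k T \<inter> U) homeomorphic_space subtopology (Euclidean_space m) W"
    unfolding Euclidean_space_eq_top_of_set subtopology_subtopology homeomorphic_space_def
    by (auto simp: W_def E_def inf.absorb2 Int_assoc[symmetric])
  ultimately show thesis using that unfolding m_def by blast
qed

text \<open>On the slice that a small box cuts out of the affine subspace, the quotient map is a
  homeomorphism onto an open subset of the stratum: gamma_k does not alter the free coordinates, so
  equivalent points differ there by integers.\<close>

lemma locally_euclidean_stratum:
  fixes T :: "'n::{finite,linorder} set"
  shows "locally_euclidean (CARD('n) - k) (subtopology (orbifold_topology (O_group k)) (stratum k T))"
  unfolding locally_euclidean_def
proof
  let ?q = "orbit_of (O_group k) :: (real, 'n) vec \<Rightarrow> _"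
  let ?X = "orbifold_topology (O_group k :: ((real, 'n) vec \<Rightarrow> (real, 'n) vec) set)"
  let ?Y = "subtopology ?X (stratum k T)"
  fix z assume "z \<in> topspace ?Y"
  then obtain x0 where x0: "x0 \<in> stratum_lift k T" "z = ?q x0" by (auto simp: stratum_def)
  \<comment> \<open>Half-width 1/2 makes the coordinates of any two points of the box differ by less
    than 1, so that integral differences vanish.\<close>
  define B where "B = {x. \<forall>i. x $ i \<in> {x0 $ i - 1 / 2 <..< x0 $ i + 1 / 2}}"
  define D where "D = stratum_lift k T \<inter> B"
  have "open B"
  proof -
    have "B = (\<Inter>i. (\<lambda>x. x $ i) -` {x0 $ i - 1 / 2 <..< x0 $ i + 1 / 2})" by (auto simp: B_def)
    moreover have "open ((\<lambda>x :: (real, 'n) vec. x $ i) -` {x0 $ i - 1 / 2 <..< x0 $ i + 1 / 2})" for i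
      by (intro open_vimage open_greaterThanLessThan continuous_on_component continuous_on_id)
    ultimately show ?thesis by auto
  qed
  \<comment> \<open>The box meets only one of the lattice translates that make up the preimage of
    the stratum.\<close>
  have lift: "x \<in> stratum_lift k T" if "x \<in> B" "?q x \<in> stratum k T" for x
    unfolding stratum_lift_def
  proof clarify
    fix i :: 'n assume i: "coord_number i \<le> k"
    then have "x $ i - half_indicator T i \<in> \<int>" using that(2) by (simp add: orbit_of_in_stratum_iff)
    moreover have "x0 $ i = half_indicator T i" using x0 i by (simp add: stratum_lift_def)
    moreover have "\<bar>x $ i - x0 $ i\<bar> < 1"
      using that(1) unfolding B_def by (auto simp: abs_if dest!: spec[of _ i])
    ultimately show "x $ i = half_indicator T i"
      using Ints_nonzero_abs_less1[of "x $ i - half_indicator T i"] by simp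
  qed
  \<comment> \<open>The slice is usually not open in R^d, so openness of its image is read off from
    the image of the full box, intersected with the stratum.\<close>
  have image: "?q ` (D \<inter> V) = ?q ` (B \<inter> V) \<inter> stratum k T" for V
    using lift by (auto simp: D_def stratum_def)
  have open_image: "openin ?Y (?q ` (D \<inter> V))" if "open V" for V
    unfolding image by (intro openin_subtopology_Int open_map_orbit_of_O_group open_Int \<open>open B\<close> that)
  have inj: "inj_on ?q D"
  proof (rule inj_onI)
    fix x y assume x: "x \<in> D" and y: "y \<in> D" and "?q x = ?q y"
    then have *: "(\<forall>i. y $ i - x $ i \<in> \<int>) \<or> (\<forall>i. y $ i - reflect_first k x $ i \<in> \<int>)"
      by (simp add: orbit_of_O_group_eq_iff mem_orbit_of_O_group_iff)
    have "x $ i = y $ i" for i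
    proof (cases "coord_number i \<le> k")
      case True
      then show ?thesis using x y by (simp add: D_def stratum_lift_def)
    next
      case False
      then have "y $ i - x $ i \<in> \<int>" using * by (metis reflect_first_nth)
      moreover have "\<bar>y $ i - x $ i\<bar> < 1"
      proof -
        have "x $ i \<in> {x0 $ i - 1 / 2 <..< x0 $ i + 1 / 2}" "y $ i \<in> {x0 $ i - 1 / 2 <..< x0 $ i + 1 / 2}"
          using x y unfolding D_def B_def by blast+
        then show ?thesis by (auto simp: abs_if)
      qed
      ultimately show ?thesis using Ints_nonzero_abs_less1[of "y $ i - x $ i"] by simp
    qed
    then show "x = y" by (simp add: vec_eq_iff)
  qed
  have D_stratum: "?q ` D \<subseteq> stratum k T" by (auto simp: D_def stratum_def)
  have top: "topspace (subtopology ?Y (?q ` D)) = ?q ` D"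
    using D_stratum by (auto simp: topspace_orbifold_topology)
  have "homeomorphic_map (top_of_set D) (subtopology ?Y (?q ` D)) ?q"
  proof (rule bijective_open_imp_homeomorphic_map)
    show "continuous_map (top_of_set D) (subtopology ?Y (?q ` D)) ?q"
      using D_stratum
      by (auto simp: continuous_map_in_subtopology intro: continuous_map_from_subtopology continuous_map_orbit_of)
    show "open_map (top_of_set D) (subtopology ?Y (?q ` D)) ?q"
      unfolding open_map_def
    proof (intro allI impI)
      fix S assume "openin (top_of_set D) S"
      then obtain V where "open V" "S = D \<inter> V" by (auto simp: openin_open)
      then have "openin (subtopology ?Y (?q ` D)) (?q ` S \<inter> ?q ` D)"
        using open_image[of V] by (simp add: openin_subtopology_Int)
      moreover have "?q ` S \<inter> ?q ` D = ?q ` S" using \<open>S = D \<inter> V\<close> by blast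
      ultimately show "openin (subtopology ?Y (?q ` D)) (?q ` S)" by simp
    qed
    show "?q ` topspace (top_of_set D) = topspace (subtopology ?Y (?q ` D))" unfolding top by simp
    show "inj_on ?q (topspace (top_of_set D))" using inj by simp
  qed
  then have "subtopology ?Y (?q ` D) homeomorphic_space top_of_set D"
    by (metis homeomorphic_map_imp_homeomorphic_space homeomorphic_space_sym)
  moreover obtain W where "openin (Euclidean_space (CARD('n) - k)) W"
    "top_of_set D homeomorphic_space subtopology (Euclidean_space (CARD('n) - k)) W"
    using stratum_lift_chart[OF \<open>open B\<close>, of k T] unfolding D_def by blast
  moreover have "openin ?Y (?q ` D)" using open_image[of UNIV] by simp
  moreover have "z \<in> ?q ` D" using x0 by (auto simp: D_def B_def)
  ultimately show "\<exists>U W. openin ?Y U \<and> z \<in> U \<and> openin (Euclidean_space (CARD('n) - k)) W \<and>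
      subtopology ?Y U homeomorphic_space subtopology (Euclidean_space (CARD('n) - k)) W"
    using homeomorphic_space_trans by blast
qed

lemma has_codimension_singular_stratum:
  fixes S :: "(real, 'n::{finite,linorder}) vec set set"
  assumes k: "1 \<le> k" "k \<le> CARD('n)" and "S \<in> singular_strata (O_group k)"
  shows "has_codimension (O_group k) S k"
proof -
  obtain T where "S = stratum k T"
    using assms(3) unfolding singular_strata_O_group[OF k(1)] by blast
  then show ?thesis using k locally_euclidean_stratum by (simp add: has_codimension_def)
qed

section \<open>Orientability\<close>

lemma orientable_M_group_iff:
  fixes a :: "(real, 'n::{finite,linorder}) vec"
  assumes a: "half_integral a" and k: "k \<le> CARD('n)"
  shows "orientable_orbifold (M_group k a) \<longleftrightarrow> even k"
proof -
  have sign: "reflection_sign k (UNIV :: 'n set) = (-1) ^ k"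
    using card_coord_number_le[OF k] by (simp add: reflection_sign_def)
  have top: "I = UNIV" if "card I = CARD('n)" for I :: "'n set"
    using that by (intro card_subset_eq) auto
  show ?thesis
  proof
    assume even: "even k"
    \<comment> \<open>The standard volume form, preserved for even k because gamma_k then has
      determinant one.\<close>
    let ?\<omega> = "form_of CARD('n) (\<lambda>I x. 1) :: (real, 'n) vec dform"
    have "continuous_form CARD('n) ?\<omega>"
      unfolding continuous_form_def using alternating_form_form_of[of "CARD('n)" "\<lambda>I x. 1"]
      by (auto simp: form_of_def)
    moreover have "invariant_form (M_group k a) ?\<omega>"
      using top sign even by (intro invariant_form_form_of a) (auto simp: minus_one_power_iff)
    moreover have "?\<omega> x (basis_list UNIV) \<noteq> 0" for x by (simp add: form_of_basis_list)
    ultimately show "orientable_orbifold (M_group k a)"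
      unfolding orientable_orbifold_def by auto
  next
    assume "orientable_orbifold (M_group k a)"
    then obtain \<omega> :: "(real, 'n) vec dform" where \<omega>: "continuous_form CARD('n) \<omega>"
      and inv: "invariant_form (M_group k a) \<omega>" and nz: "\<And>x. \<exists>vs. \<omega> x vs \<noteq> 0"
      unfolding orientable_orbifold_def by auto
    define f where "f x = \<omega> x (basis_list UNIV)" for x
    have alt: "alternating_form CARD('n) (\<omega> x)" for x
      using \<omega> by (simp add: continuous_form_def)
    have f0: "f x \<noteq> 0" for x
      \<comment> \<open>In top degree there is only one increasing basis list, so its value decides
        whether the form vanishes at x.\<close>
      using nz[of x] alternating_form_eq_0[OF alt, of x] top unfolding f_def by metis
    have f_reflect: "f x = (-1) ^ k * f (reflect_first k (x + a))" for x
    proof -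
      have "f x = \<omega> (reflect_first k (x + a)) (map (reflect_first k) (basis_list UNIV))"
        using inv unfolding invariant_form_M_group_iff[OF a] f_def by simp
      also have "\<dots> = (-1) ^ k * f (reflect_first k (x + a))"
        unfolding f_def sign[symmetric] by (rule alternating_form_reflect_basis_list[OF alt])
      finally show ?thesis .
    qed
    have "connected (range f)"
      using \<omega> by (intro connected_continuous_image) (auto simp: f_def continuous_form_def)
    show "even k"
    proof (rule ccontr)
      assume "odd k"
      then have "f (reflect_first k (0 + a)) = - f 0" using f_reflect[of 0] by simp
      \<comment> \<open>Absolute values order the two opposite values of f, whatever the sign of
        \<open>f 0\<close>, as the interval property requires.\<close>
      then have "\<bar>f 0\<bar> \<in> range f" "- \<bar>f 0\<bar> \<in> range f"
        by (metis abs_if rangeI minus_minus)+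
      then have "0 \<in> range f"
        using connectedD_interval[OF \<open>connected (range f)\<close>, of "- \<bar>f 0\<bar>" "\<bar>f 0\<bar>" 0] by simp
      then show False using f0 by force
    qed
  qed
qed

theorem proposition3p5:
  fixes p :: nat
  assumes "2 \<le> CARD('n::{finite,linorder})" and "p \<le> CARD('n)"
  shows
    "(\<forall>k\<in>{1..CARD('n) - 1}. \<forall>a :: (real, 'n) vec. half_vector k a \<longrightarrow>
        krawtchouk CARD('n) p (real k) = 0 \<longrightarrow>
        p_isospectral p (O_group k) (M_group k a))
   \<and> (\<forall>k\<in>{1..CARD('n) - 1}. \<forall>k'\<in>{1..CARD('n) - 1}. \<forall>a a' :: (real, 'n) vec.
        half_vector k a \<longrightarrow> half_vector k' a' \<longrightarrow> k' \<noteq> k \<longrightarrow>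
        krawtchouk CARD('n) p (real k) = 0 \<longrightarrow> krawtchouk CARD('n) p (real k') = 0 \<longrightarrow>
        (\<forall>\<Gamma>\<in>{M_group k a, M_group k' a', O_group k, O_group k'}.
         \<forall>\<Gamma>'\<in>{M_group k a, M_group k' a', O_group k, O_group k'}. p_isospectral p \<Gamma> \<Gamma>'))
   \<and> (\<forall>k\<in>{1..CARD('n) - 1}. \<forall>a :: (real, 'n) vec. half_vector k a \<longrightarrow>
        is_manifold (M_group k a)
      \<and> singular_set (O_group k :: ((real, 'n) vec \<Rightarrow> (real, 'n) vec) set)
          = \<Union>(singular_strata (O_group k))
      \<and> card (singular_strata (O_group k :: ((real, 'n) vec \<Rightarrow> (real, 'n) vec) set)) = 2 ^ k
      \<and> (\<forall>S\<in>singular_strata (O_group k :: ((real, 'n) vec \<Rightarrow> (real, 'n) vec) set).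
            has_codimension (O_group k) S k))
   \<and> (\<forall>k\<in>{1..CARD('n) - 1}. \<forall>a :: (real, 'n) vec. half_vector k a \<longrightarrow>
        (orientable_orbifold (O_group k :: ((real, 'n) vec \<Rightarrow> (real, 'n) vec) set) \<longleftrightarrow> even k)
      \<and> (orientable_orbifold (M_group k a) \<longleftrightarrow> even k))"
proof -
  have half: "half_integral a" if "half_vector k a" for k and a :: "(real, 'n) vec"
    using that by (simp add: half_vector_def half_integral_def)
  have isospectral: "p_isospectral p \<Gamma> \<Gamma>'"
    if zero: "krawtchouk CARD('n) p (real k) = 0" "krawtchouk CARD('n) p (real k') = 0"
      and k: "k \<in> {1..CARD('n) - 1}" "k' \<in> {1..CARD('n) - 1}"
      and a: "half_vector k a" "half_vector k' a'"
      and \<Gamma>: "\<Gamma> \<in> {M_group k a, M_group k' a', O_group k, O_group k'}"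
      and \<Gamma>': "\<Gamma>' \<in> {M_group k a, M_group k' a', O_group k, O_group k'}"
    for k k' \<Gamma> \<Gamma>' and a a' :: "(real, 'n) vec"
  proof -
    \<comment> \<open>Each of the four groups is some \<open>M_group l b\<close> with l a zero,
      taking b = 0 for the orbifold groups, so one comparison settles all sixteen pairs.\<close>
    have M: "\<exists>l b. \<Delta> = M_group l b \<and> half_integral b \<and> l \<le> CARD('n) \<and> krawtchouk CARD('n) p (real l) = 0"
      if \<Delta>: "\<Delta> \<in> {M_group k a, M_group k' a', O_group k, O_group k'}" for \<Delta>
    proof -
      have "k \<le> CARD('n)" "k' \<le> CARD('n)" using k by auto
      then show ?thesis
        using \<Delta> zero half[OF a(1)] half[OF a(2)] half_integral_0 unfolding O_group_eq_M_group by blast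
    qed
    show ?thesis using M[OF \<Gamma>] M[OF \<Gamma>'] p_isospectral_M_group by blast
  qed
  have "singular_set (O_group k :: ((real, 'n) vec \<Rightarrow> (real, 'n) vec) set) = \<Union>(singular_strata (O_group k))"
    if "1 \<le> k" for k
    using Union_strata[OF that] singular_strata_O_group[OF that] by metis
  then have strata: "is_manifold (M_group k a)
      \<and> singular_set (O_group k :: ((real, 'n) vec \<Rightarrow> (real, 'n) vec) set)
          = \<Union>(singular_strata (O_group k))
      \<and> card (singular_strata (O_group k :: ((real, 'n) vec \<Rightarrow> (real, 'n) vec) set)) = 2 ^ k
      \<and> (\<forall>S\<in>singular_strata (O_group k :: ((real, 'n) vec \<Rightarrow> (real, 'n) vec) set).
            has_codimension (O_group k) S k)"
    if "k \<in> {1..CARD('n) - 1}" "half_vector k a" for k and a :: "(real, 'n) vec"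
    using that by (auto simp: is_manifold_M_group card_singular_strata_O_group has_codimension_singular_stratum)
  have orientable: "orientable_orbifold (M_group k b) \<longleftrightarrow> even k"
    if "k \<in> {1..CARD('n) - 1}" "half_integral b" for k and b :: "(real, 'n) vec"
    using that by (intro orientable_M_group_iff) auto
  show ?thesis
  proof ((intro conjI; intro ballI allI impI), goal_cases)
    \<comment> \<open>The isospectrality for a single zero is the comparison of the four groups with
      k' = k and a' = a.\<close>
    case (1 k a)
    then show ?case by (intro isospectral[of k k a a]) auto
  next
    case (2 k k' a a' \<Gamma> \<Gamma>')
    then show ?case by (intro isospectral[of k k' a a'])
  next
    case (3 k a)
    then show ?case by (rule strata)
  next
    case (4 k a)
    then show ?case using half orientable half_integral_0 O_group_eq_M_group by metis
  qed
qed

end
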